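(* Let $U=\sum_{j=0}^3c_j\sigma_j\otimes\sigma_j$ be a normalized two-qubit unitary with $c_2=c_3$ (equivalently $y=z$). Then $$K_E(U)=\max_{\alpha,\beta\in[0,\pi/2]}E(\varphi(\alpha,\beta;\tfrac{\pi}{2},\tfrac{\pi}{2})),$$ i.e. the maximum in the definition of $K_E(U)$ is attained at an input of the form $(\cos\alpha|00\rangle+\sin\alpha|11\rangle)_{AR_A}\otimes(\cos\beta|00\rangle+\sin\beta|11\rangle)_{BR_B}$.
   Context: Pauli matrices: $\sigma_0=I$, $\sigma_1=\begin{pmatrix}0&1\\1&0\end{pmatrix}$, $\sigma_2=\begin{pmatrix}0&-i\\i&0\end{pmatrix}$, $\sigma_3=\begin{pmatrix}1&0\\0&-1\end{pmatrix}$. For real $x,y,z$ set $c_0=\cos x\cos y\cos z+i\sin x\sin y\sin z$, $c_1=\cos x\sin y\sin z+i\sin x\cos y\cos z$, $c_2=\sin x\cos y\sin z+i\cos x\sin y\cos z$, $c_3=\sin x\sin y\cos z+i\cos x\cos y\sin z$, and $U=\sum_{j=0}^3c_j\sigma_j\otimes\sigma_j$ acting on qubits $A,B$. $U$ is called normalized if $\pi/4\ge x\ge y\ge z\ge0$ and $0<y<\pi/4$. The entangling power is $K_E(U)=\max E\big(U(|\phi\rangle_{AR_A}\otimes|\psi\rangle_{BR_B})\big)$, the maximum over pure states on $AR_A$ and $BR_B$ with arbitrary finite-dimensional ancillas $R_A,R_B$ ($U$ acting on $A,B$), where $E(|\chi\rangle)=S(\mathrm{Tr}_{AR_A}|\chi\rangle\langle\chi|)$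 is the von Neumann entropy, base-2 logarithm. $E(\varphi(\alpha,\beta;\frac{\pi}{2},\frac{\pi}{2}))$ denotes $E$ of $U\big((\cos\alpha|00\rangle+\sin\alpha|11\rangle)_{AR_A}\otimes(\cos\beta|00\rangle+\sin\beta|11\rangle)_{BR_B}\big)$ with $R_A,R_B$ qubits. *)

theory Defs
  imports Complex_Main "Jordan_Normal_Form.Char_Poly"
begin

definition pauli :: "nat \<Rightarrow> nat \<Rightarrow> nat \<Rightarrow> complex" where
  "pauli j a b =
    (if j = 0 then (if a = b then 1 else 0)
     else if j = 1 then (if a \<noteq> b then 1 else 0)
     else if j = 2 then (if a = 0 \<and> b = 1 then - \<i> else if a = 1 \<and> b = 0 then \<i> else 0)
     else (if a = b then (if a = 0 then 1 else -1) else 0))"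

definition coef :: "real \<Rightarrow> real \<Rightarrow> real \<Rightarrow> nat \<Rightarrow> complex" where
  "coef x y z j =
    (if j = 0 then Complex (cos x * cos y * cos z) (sin x * sin y * sin z)
     else if j = 1 then Complex (cos x * sin y * sin z) (sin x * cos y * cos z)
     else if j = 2 then Complex (sin x * cos y * sin z) (cos x * sin y * cos z)
     else Complex (sin x * sin y * cos z) (cos x * cos y * sin z))"

definition Uent :: "real \<Rightarrow> real \<Rightarrow> real \<Rightarrow> nat \<Rightarrow> nat \<Rightarrow> nat \<Rightarrow> nat \<Rightarrow> complex" where
  "Uent x y z a b a' b' = (\<Sum>j<4. coef x y z j * pauli j a a' * pauli j b b')"

definition normalized_U :: "real \<Rightarrow> real \<Rightarrow> real \<Rightarrow> bool" where
  "normalized_U x y z \<longleftrightarrow> pi/4 \<ge> x \<and> x \<ge> y \<and> y \<ge> z \<and> z \<ge> 0 \<and> 0 < y \<and> y < pi/4"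

text \<open>A pure state on a qubit (index a < 2) tensor an ancilla of dimension m (index r < m),
  given by its coefficient function; only entries with a < 2, r < m matter.\<close>
definition unit_state :: "nat \<Rightarrow> (nat \<Rightarrow> nat \<Rightarrow> complex) \<Rightarrow> bool" where
  "unit_state m \<phi> \<longleftrightarrow> (\<Sum>a<2. \<Sum>r<m. (cmod (\<phi> a r))\<^sup>2) = 1"

text \<open>Output amplitude <a b r s| U (phi (x) psi), with a on A, b on B, r on R_A, s on R_B.\<close>
definition out_amp :: "real \<Rightarrow> real \<Rightarrow> real \<Rightarrow> (nat \<Rightarrow> nat \<Rightarrow> complex) \<Rightarrow> (nat \<Rightarrow> nat \<Rightarrow> complex)
    \<Rightarrow> nat \<Rightarrow> nat \<Rightarrow> nat \<Rightarrow> nat \<Rightarrow> complex" where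
  "out_amp x y z \<phi> \<psi> a b r s = (\<Sum>a'<2. \<Sum>b'<2. Uent x y z a b a' b' * \<phi> a' r * \<psi> b' s)"

text \<open>Reduced density matrix on B R_B (partial trace over A R_A), a (2n)x(2n) matrix whose
  row/column index i encodes (b, s) = (i div n, i mod n).\<close>
definition reduced_BR :: "nat \<Rightarrow> nat \<Rightarrow> (nat \<Rightarrow> nat \<Rightarrow> nat \<Rightarrow> nat \<Rightarrow> complex) \<Rightarrow> complex mat" where
  "reduced_BR m n \<Psi> = mat (2*n) (2*n) (\<lambda>(i, k).
      \<Sum>a<2. \<Sum>r<m. \<Psi> a (i div n) r (i mod n) * cnj (\<Psi> a (k div n) r (k mod n)))"

text \<open>Von Neumann entropy (base 2): - sum over eigenvalues (with algebraic multiplicity,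
  i.e. roots of the characteristic polynomial) of lambda log2 lambda; 0 log 0 = 0
  holds automatically since log 2 0 = 0 in Isabelle.\<close>
definition vn_entropy :: "complex mat \<Rightarrow> real" where
  "vn_entropy \<rho> = - (\<Sum>ev\<in>{ev. poly (char_poly \<rho>) ev = 0}.
       real (order ev (char_poly \<rho>)) * (Re ev * log 2 (Re ev)))"

definition ent_out :: "real \<Rightarrow> real \<Rightarrow> real \<Rightarrow> nat \<Rightarrow> nat \<Rightarrow> (nat \<Rightarrow> nat \<Rightarrow> complex)
    \<Rightarrow> (nat \<Rightarrow> nat \<Rightarrow> complex) \<Rightarrow> real" where
  "ent_out x y z m n \<phi> \<psi> = vn_entropy (reduced_BR m n (out_amp x y z \<phi> \<psi>))"

definition KE_set :: "real \<Rightarrow> real \<Rightarrow> real \<Rightarrow> real set" where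
  "KE_set x y z = {ent_out x y z m n \<phi> \<psi> | m n \<phi> \<psi>.
       0 < m \<and> 0 < n \<and> unit_state m \<phi> \<and> unit_state n \<psi>}"

definition KE :: "real \<Rightarrow> real \<Rightarrow> real \<Rightarrow> real" where
  "KE x y z = Sup (KE_set x y z)"

definition two_qubit_state :: "real \<Rightarrow> nat \<Rightarrow> nat \<Rightarrow> complex" where
  "two_qubit_state t a r = (if a = 0 \<and> r = 0 then complex_of_real (cos t)
      else if a = 1 \<and> r = 1 then complex_of_real (sin t) else 0)"

definition E_phi :: "real \<Rightarrow> real \<Rightarrow> real \<Rightarrow> real \<Rightarrow> real \<Rightarrow> real" where
  "E_phi x y z \<alpha> \<beta> = ent_out x y z 2 2 (two_qubit_state \<alpha>) (two_qubit_state \<beta>)"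

end

theory Submission
  imports Defs "HOL-Real_Asymp.Real_Asymp" "HOL-Analysis.Convex"
begin

text \<open>
  The entropy of a state \<open>\<rho>\<close> is an increasing function of \<open>det (1 + t \<rho>)\<close>, \<open>t > 0\<close>, because
  \<open>-\<lambda> ln \<lambda> = \<integral> (ln (1 + \<lambda> t) - \<lambda> ln (1 + t)) dt / t\<^sup>2\<close> over \<open>(0, \<infinity>)\<close>. For the output of \<open>U\<close> this determinant is that of a
  4 x 4 matrix built from the Gram matrices of the vectors \<open>\<sigma>\<^sub>j \<phi>\<close> and \<open>\<sigma>\<^sub>j \<psi>\<close>, so it is a quartic polynomial in \<open>t\<close> whose
  coefficients are explicit in the Bloch vectors \<open>a\<close>, \<open>b\<close> of the two input qubits. It therefore suffices to find, for
  all \<open>a\<close>, \<open>b\<close> in the unit ball, some \<open>s \<in> [0, 1]\<close> such that all coefficients for \<open>(a, b)\<close> are at most those for the axis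
  vectors \<open>(0, 0, \<surd>s)\<close>, \<open>(0, 0, -\<surd>s)\<close>, which are Bloch vectors of inputs of the required form. If \<open>2x + 2y \<ge> \<pi>/2\<close>, then
  \<open>s = 0\<close> works. Otherwise take \<open>s = max 0 (- a2 b2 - a3 b3) + (tan 2y / tan 2x) max 0 (- a1 b1)\<close>. On the axis family the
  eigenvalues are explicit and continuous in \<open>s\<close>, hence the maximum is attained.
\<close>

text \<open>Because c2 = c3, \<open>U\<close> commutes with equal rotations of both qubits about the
  first axis, so only quantities invariant under such rotations enter; they become the parameters of
  \<open>gap_setup\<close>. One s has to serve all t > 0 at once, hence the comparison coefficient
  by coefficient. The t^3 and t^4 coefficients contain the factor (1 - |a|^2)(1 - |b|^2) and are
  dominated by Cauchy-Schwarz. The obstacle is t^2: for non-collinear vectors it has a term of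
  indefinite sign, proportional to (a1 - b1)(a2 b3 - a3 b2), and most of the inequalities exist to
  absorb it. An axis pair with parameter s has inner product -s. If x = y, then \<open>U\<close>
  commutes with all equal rotations and s = -a.b is the natural match. For x > y the share of the
  first axis is discounted by tan 2y / tan 2x, a factor that is 1 at x = y and 0 at x =
  pi/4.\<close>

section \<open>Entropy and the spectral polynomial\<close>

text \<open>As a function of \<open>t\<close> this is a primitive of \<open>ln (1 + \<mu> t) / t\<^sup>2\<close>; its increment from \<open>0\<close> to \<open>\<infinity>\<close>
  is the entropy contribution of the eigenvalue \<open>\<mu>\<close>, up to terms linear in \<open>\<mu>\<close>.\<close>

definition entropy_kernel :: "real \<Rightarrow> real \<Rightarrow> real" where
  "entropy_kernel \<mu> t = \<mu> * ln t - \<mu> * ln (1 + \<mu> * t) - ln (1 + \<mu> * t) / t"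

lemma entropy_kernel_deriv:
  assumes "\<mu> \<ge> 0" "t > 0"
  shows "(entropy_kernel \<mu> has_real_derivative ln (1 + \<mu> * t) / t\<^sup>2) (at t)"
proof -
  have pos: "1 + \<mu> * t > 0" using assms by (simp add: add_pos_nonneg)
  have "((\<lambda>t. \<mu> * ln t - \<mu> * ln (1 + \<mu> * t) - ln (1 + \<mu> * t) / t) has_real_derivative
      (\<mu> * (1 / t) - \<mu> * (\<mu> / (1 + \<mu> * t)) - ((\<mu> / (1 + \<mu> * t)) * t - ln (1 + \<mu> * t)) / (t * t))) (at t)"
    using pos assms by (auto intro!: derivative_eq_intros)
  moreover have "\<mu> * (1 / t) - \<mu> * (\<mu> / (1 + \<mu> * t)) - ((\<mu> / (1 + \<mu> * t)) * t - ln (1 + \<mu> * t)) / (t * t)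
      = ln (1 + \<mu> * t) / t\<^sup>2"
    using pos assms by (simp add: divide_simps power2_eq_square) (simp add: algebra_simps)
  ultimately show ?thesis unfolding entropy_kernel_def[abs_def] by simp
qed

lemma entropy_kernel_at_top:
  assumes "\<mu> \<ge> 0"
  shows "(entropy_kernel \<mu> \<longlongrightarrow> - (\<mu> * ln \<mu>)) at_top"
proof (cases "\<mu> = 0")
  case True
  then show ?thesis by (simp add: entropy_kernel_def[abs_def])
next
  case False
  with assms have "\<mu> > 0" by simp
  then show ?thesis unfolding entropy_kernel_def[abs_def] by real_asymp
qed

lemma entropy_kernel_at_0:
  assumes "\<mu> \<ge> 0"
  shows "((\<lambda>t. entropy_kernel \<mu> t - \<mu> * ln t) \<longlongrightarrow> - \<mu>) (at_right 0)"
proof (cases "\<mu> = 0")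
  case True
  then show ?thesis by (simp add: entropy_kernel_def[abs_def])
next
  case False
  with assms have "\<mu> > 0" by simp
  then show ?thesis unfolding entropy_kernel_def[abs_def] by real_asymp
qed

lemma tendsto_sum_list_map:
  fixes f :: "'a \<Rightarrow> 'b \<Rightarrow> real"
  assumes "\<And>x. x \<in> set xs \<Longrightarrow> (f x \<longlongrightarrow> g x) F"
  shows "((\<lambda>t. \<Sum>x\<leftarrow>xs. f x t) \<longlongrightarrow> (\<Sum>x\<leftarrow>xs. g x)) F"
  using assms by (induction xs) (auto intro!: tendsto_add)

lemma deriv_sum_list_map:
  fixes f :: "'a \<Rightarrow> real \<Rightarrow> real"
  assumes "\<And>x. x \<in> set xs \<Longrightarrow> (f x has_real_derivative g x) F"
  shows "((\<lambda>t. \<Sum>x\<leftarrow>xs. f x t) has_real_derivative (\<Sum>x\<leftarrow>xs. g x)) F"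
  using assms by (induction xs) (auto intro!: derivative_eq_intros)

lemma ln_prod_list_map:
  fixes f :: "'a \<Rightarrow> real"
  assumes "\<And>x. x \<in> set xs \<Longrightarrow> f x > 0"
  shows "(\<Prod>x\<leftarrow>xs. f x) > 0" "ln (\<Prod>x\<leftarrow>xs. f x) = (\<Sum>x\<leftarrow>xs. ln (f x))"
proof -
  have "(\<Prod>x\<leftarrow>xs. f x) > 0 \<and> ln (\<Prod>x\<leftarrow>xs. f x) = (\<Sum>x\<leftarrow>xs. ln (f x))"
    using assms
  proof (induction xs)
    case (Cons a xs)
    then have "f a > 0" "(\<Prod>x\<leftarrow>xs. f x) > 0" "ln (\<Prod>x\<leftarrow>xs. f x) = (\<Sum>x\<leftarrow>xs. ln (f x))" by auto
    then show ?case by (simp add: ln_mult_pos)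
  qed simp
  then show "(\<Prod>x\<leftarrow>xs. f x) > 0" "ln (\<Prod>x\<leftarrow>xs. f x) = (\<Sum>x\<leftarrow>xs. ln (f x))" by auto
qed

text \<open>Working with primitives turns the comparison of integrals into monotonicity of
  \<open>G\<close>, whose derivative is the difference of the logarithms of the two products over
  t^2. Equal sums cancel the singular terms \<open>\<mu> * ln t\<close>, so \<open>G\<close> starts
  at 0; its limit at infinity is the difference of the entropies.\<close>

lemma entropy_mono_spectral_poly:
  fixes ls ms :: "real list"
  assumes ls: "\<And>l. l \<in> set ls \<Longrightarrow> l \<ge> 0" and ms: "\<And>m. m \<in> set ms \<Longrightarrow> m \<ge> 0"
    and eq: "sum_list ls = sum_list ms"
    and le: "\<And>t. t > 0 \<Longrightarrow> (\<Prod>l\<leftarrow>ls. 1 + l * t) \<le> (\<Prod>m\<leftarrow>ms. 1 + m * t)"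
  shows "- (\<Sum>l\<leftarrow>ls. l * ln l) \<le> - (\<Sum>m\<leftarrow>ms. m * ln m)"
proof -
  define G where "G t = (\<Sum>m\<leftarrow>ms. entropy_kernel m t) - (\<Sum>l\<leftarrow>ls. entropy_kernel l t)" for t
  have dG: "(G has_real_derivative
      ((\<Sum>m\<leftarrow>ms. ln (1 + m * t) / t\<^sup>2) - (\<Sum>l\<leftarrow>ls. ln (1 + l * t) / t\<^sup>2))) (at t)" if "t > 0" for t
    unfolding G_def[abs_def]
    by (intro DERIV_diff deriv_sum_list_map entropy_kernel_deriv ls ms that)
  have dpos: "(\<Sum>m\<leftarrow>ms. ln (1 + m * t) / t\<^sup>2) - (\<Sum>l\<leftarrow>ls. ln (1 + l * t) / t\<^sup>2) \<ge> 0" if t: "t > 0" for t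
  proof -
    have pl: "1 + l * t > 0" if "l \<in> set ls" for l using ls[OF that] t by (simp add: add_pos_nonneg)
    have pm: "1 + m * t > 0" if "m \<in> set ms" for m using ms[OF that] t by (simp add: add_pos_nonneg)
    have "ln (\<Prod>l\<leftarrow>ls. 1 + l * t) \<le> ln (\<Prod>m\<leftarrow>ms. 1 + m * t)"
      using le[OF t] ln_prod_list_map(1)[of ls "\<lambda>l. 1 + l * t", OF pl]
        ln_prod_list_map(1)[of ms "\<lambda>l. 1 + l * t", OF pm] by simp
    then have "(\<Sum>l\<leftarrow>ls. ln (1 + l * t)) \<le> (\<Sum>m\<leftarrow>ms. ln (1 + m * t))"
      using ln_prod_list_map(2)[of ls "\<lambda>l. 1 + l * t", OF pl]
        ln_prod_list_map(2)[of ms "\<lambda>l. 1 + l * t", OF pm] by simp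
    then have "(\<Sum>l\<leftarrow>ls. ln (1 + l * t)) / t\<^sup>2 \<le> (\<Sum>m\<leftarrow>ms. ln (1 + m * t)) / t\<^sup>2"
      by (rule divide_right_mono) simp
    then show ?thesis by (simp add: divide_inverse sum_list_mult_const)
  qed
  have mono: "G s \<le> G t" if "0 < s" "s \<le> t" for s t
  proof (rule DERIV_nonneg_imp_nondecreasing[of s t G])
    fix u assume "s \<le> u" "u \<le> t"
    with that have "u > 0" by simp
    then show "\<exists>y. (G has_real_derivative y) (at u) \<and> 0 \<le> y" using dG dpos by blast
  qed (use that in simp)
  have "((\<lambda>t. (\<Sum>m\<leftarrow>ms. entropy_kernel m t - m * ln t) - (\<Sum>l\<leftarrow>ls. entropy_kernel l t - l * ln t))
      \<longlongrightarrow> (\<Sum>m\<leftarrow>ms. - m) - (\<Sum>l\<leftarrow>ls. - l)) (at_right 0)"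
    by (intro tendsto_diff tendsto_sum_list_map entropy_kernel_at_0 ls ms)
  moreover have "(\<Sum>m\<leftarrow>ms. - m) - (\<Sum>l\<leftarrow>ls. - l) = 0"
    using eq by (simp add: uminus_sum_list_map[symmetric, of "\<lambda>x. x", simplified o_def])
  moreover have "(\<Sum>m\<leftarrow>ms. entropy_kernel m t - m * ln t) - (\<Sum>l\<leftarrow>ls. entropy_kernel l t - l * ln t) = G t" for t
    using eq by (simp add: G_def sum_list_subtractf sum_list_mult_const)
  ultimately have G0: "(G \<longlongrightarrow> 0) (at_right 0)" by simp
  have Gpos: "0 \<le> G t" if "t > 0" for t
  proof (rule tendsto_upperbound[OF G0])
    show "\<forall>\<^sub>F s in at_right 0. G s \<le> G t"
      using mono that by (auto simp: eventually_at_right_field intro!: exI[of _ t])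
  qed simp
  have "(G \<longlongrightarrow> (\<Sum>m\<leftarrow>ms. - (m * ln m)) - (\<Sum>l\<leftarrow>ls. - (l * ln l))) at_top"
    unfolding G_def[abs_def]
    by (intro tendsto_diff tendsto_sum_list_map entropy_kernel_at_top ls ms)
  then have "0 \<le> (\<Sum>m\<leftarrow>ms. - (m * ln m)) - (\<Sum>l\<leftarrow>ls. - (l * ln l))"
    by (rule tendsto_lowerbound) (use Gpos in \<open>auto intro: eventually_mono[OF eventually_gt_at_top[of 0]]\<close>)
  then show ?thesis
    by (simp add: uminus_sum_list_map[symmetric, of "\<lambda>x. x * ln x", simplified o_def])
qed

section \<open>From determinants det (1 + t A) to eigenvalue lists\<close>

lemma det_one_plus_smult_eq_prod:
  fixes A :: "complex mat"
  assumes A: "A \<in> carrier_mat k k" and cp: "char_poly A = (\<Prod>a\<leftarrow>as. [:- a, 1:])" and len: "length as = k"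
  shows "det (1\<^sub>m k + t \<cdot>\<^sub>m A) = (\<Prod>a\<leftarrow>as. 1 + t * a)"
proof (cases "t = 0")
  case True
  have "1\<^sub>m k + 0 \<cdot>\<^sub>m A = 1\<^sub>m k" using A by auto
  moreover have "(\<Prod>a\<leftarrow>as. 1 + 0 * a) = 1" by (induction as) auto
  ultimately show ?thesis using True by (simp only: det_one)
next
  case False
  \<comment> \<open>The determinant is a rescaled value of the characteristic polynomial at -1/t,
    which is why t = 0 was split off.\<close>
  have eq: "1\<^sub>m k + t \<cdot>\<^sub>m A = (- t) \<cdot>\<^sub>m (- char_matrix A (- 1 / t))"
    using A False by (intro eq_matI) (auto simp: char_matrix_def field_simps)
  have "det (1\<^sub>m k + t \<cdot>\<^sub>m A) = (- t) ^ k * poly (char_poly A) (- 1 / t)"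
    unfolding eq using A by (simp add: det_smult char_poly_matrix[OF A] char_matrix_def)
  also have "\<dots> = (- t) ^ length as * (\<Prod>a\<leftarrow>as. - a - 1 / t)"
    by (simp add: cp poly_prod_list o_def len)
  also have "\<dots> = (\<Prod>a\<leftarrow>as. 1 + t * a)"
    using False by (induction as) (auto simp: field_simps)
  finally show ?thesis .
qed

lemma sum_count_list_mult:
  fixes f :: "'a \<Rightarrow> real"
  assumes "finite S" "set as \<subseteq> S"
  shows "(\<Sum>x\<in>S. real (count_list as x) * f x) = (\<Sum>a\<leftarrow>as. f a)"
  using assms(2)
proof (induction as)
  case (Cons a as)
  have "(\<Sum>x\<in>S. real (count_list (a # as) x) * f x) =
      (\<Sum>x\<in>S. (if a = x then f x else 0) + real (count_list as x) * f x)"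
    by (intro sum.cong) (auto simp: algebra_simps)
  then show ?case using Cons assms(1) by (simp add: sum.distrib sum.delta')
qed simp

text \<open>Converts the form used in \<open>vn_entropy\<close>, distinct roots weighted by
  multiplicity, into a sum over linear factors with repetition.\<close>

lemma sum_order_prod_list:
  fixes as :: "complex list" and f :: "complex \<Rightarrow> real"
  defines "p \<equiv> (\<Prod>a\<leftarrow>as. [:- a, 1:])"
  shows "(\<Sum>ev | poly p ev = 0. real (order ev p) * f ev) = (\<Sum>a\<leftarrow>as. f a)"
proof -
  have ord: "order ev p = count_list as ev" for ev
    unfolding p_def
  proof (induction as)
    case (Cons a as)
    have "(\<Prod>a\<leftarrow>as. [:- a, 1:]) \<noteq> 0" by (auto simp: prod_list_zero_iff)
    then have "order ev ([:- a, 1:] * (\<Prod>a\<leftarrow>as. [:- a, 1:])) =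
        order ev [:- a, 1:] + order ev (\<Prod>a\<leftarrow>as. [:- a, 1:])"
      by (intro order_mult) (simp only: mult_eq_0_iff, simp)
    then show ?case using Cons by (simp add: order_linear')
  qed simp
  have "{ev. poly p ev = 0} = set as"
    unfolding p_def by (auto simp: poly_prod_list prod_list_zero_iff)
  then show ?thesis
    by (simp add: ord sum_count_list_mult)
qed

definition nonneg_spectrum :: "complex mat \<Rightarrow> bool" where
  "nonneg_spectrum A \<longleftrightarrow> (\<forall>ev. eigenvalue A ev \<longrightarrow> Im ev = 0 \<and> Re ev \<ge> 0)"

text \<open>The determinant identity lets matrices of different sizes be compared: a zero eigenvalue
  contributes a factor 1 to the product and nothing to the entropy.\<close>

lemma vn_entropy_spectrum:
  assumes A: "A \<in> carrier_mat k k" and psd: "nonneg_spectrum A"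
  obtains ls where "\<And>l. l \<in> set ls \<Longrightarrow> l \<ge> 0"
    "\<And>t::real. det (1\<^sub>m k + of_real t \<cdot>\<^sub>m A) = of_real (\<Prod>l\<leftarrow>ls. 1 + l * t)"
    "vn_entropy A = - (\<Sum>l\<leftarrow>ls. l * ln l) / ln 2"
proof -
  obtain as where as: "char_poly A = (\<Prod>a\<leftarrow>as. [:- a, 1:])" "length as = k"
    using char_poly_factorized[OF A] by blast
  have root: "Im a = 0 \<and> Re a \<ge> 0" if "a \<in> set as" for a
  proof -
    have "poly (char_poly A) a = 0" using that as by (auto simp: poly_prod_list prod_list_zero_iff)
    then have "eigenvalue A a" using eigenvalue_root_char_poly[OF A] by simp
    then show ?thesis using psd by (simp add: nonneg_spectrum_def)
  qed
  show thesis
  proof (rule that[of "map Re as"])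
    show "l \<ge> 0" if "l \<in> set (map Re as)" for l using root that by auto
    show "det (1\<^sub>m k + of_real t \<cdot>\<^sub>m A) = of_real (\<Prod>l\<leftarrow>map Re as. 1 + l * t)" for t :: real
    proof -
      have "(\<Prod>a\<leftarrow>as. 1 + of_real t * a) = of_real (\<Prod>a\<leftarrow>as. 1 + Re a * t)"
        using root by (induction as) (auto simp: complex_eq_iff)
      then show ?thesis using det_one_plus_smult_eq_prod[OF A as, of "of_real t"] by (simp add: o_def)
    qed
    show "vn_entropy A = - (\<Sum>l\<leftarrow>map Re as. l * ln l) / ln 2"
      unfolding vn_entropy_def as(1) sum_order_prod_list
      by (simp add: log_def o_def divide_inverse sum_list_mult_const[symmetric] mult.assoc)
  qed
qed

text \<open>Recovers the trace from the determinant polynomial;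
  \<open>entropy_mono_spectral_poly\<close> requires equal traces.\<close>

lemma prod_list_affine_deriv_0:
  "((\<lambda>t::real. \<Prod>l\<leftarrow>ls. 1 + l * t) has_real_derivative sum_list ls) (at 0)"
proof (induction ls)
  case (Cons a ls)
  have "((\<lambda>t. (1 + a * t) * (\<Prod>l\<leftarrow>ls. 1 + l * t)) has_real_derivative
     (1 + a * 0) * sum_list ls + a * (\<Prod>l\<leftarrow>ls. 1 + l * 0)) (at 0)"
    by (intro DERIV_mult' Cons.IH) (auto intro!: derivative_eq_intros)
  moreover have "(\<Prod>l\<leftarrow>ls. 1 + l * (0::real)) = 1" by (induction ls) auto
  ultimately show ?case by (simp add: add.commute)
qed simp

lemma sum_list_eq_of_prod_affine:
  fixes ls :: "real list"
  assumes "\<And>t. (\<Prod>l\<leftarrow>ls. 1 + l * t) = 1 + u * t + a * t\<^sup>2 + b * t ^ 3 + c * t ^ 4"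
  shows "sum_list ls = u"
proof -
  have "((\<lambda>t. 1 + u * t + a * t\<^sup>2 + b * t ^ 3 + c * t ^ 4) has_real_derivative u) (at 0)"
    by (auto intro!: derivative_eq_intros)
  then show ?thesis using prod_list_affine_deriv_0[of ls] assms DERIV_unique by fastforce
qed

text \<open>The linear coefficient 1 encodes trace one. For t > 0, ordered higher coefficients order
  the two polynomials pointwise.\<close>

lemma vn_entropy_mono:
  assumes A: "A \<in> carrier_mat k k" "nonneg_spectrum A" and B: "B \<in> carrier_mat n n" "nonneg_spectrum B"
    and dA: "\<And>t::real. det (1\<^sub>m k + of_real t \<cdot>\<^sub>m A) = of_real (1 + t + a2 * t\<^sup>2 + a3 * t ^ 3 + a4 * t ^ 4)"
    and dB: "\<And>t::real. det (1\<^sub>m n + of_real t \<cdot>\<^sub>m B) = of_real (1 + t + b2 * t\<^sup>2 + b3 * t ^ 3 + b4 * t ^ 4)"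
    and le: "a2 \<le> b2" "a3 \<le> b3" "a4 \<le> b4"
  shows "vn_entropy A \<le> vn_entropy B"
proof -
  obtain ls where ls: "\<And>l. l \<in> set ls \<Longrightarrow> l \<ge> 0"
    "\<And>t::real. det (1\<^sub>m k + of_real t \<cdot>\<^sub>m A) = of_real (\<Prod>l\<leftarrow>ls. 1 + l * t)"
    "vn_entropy A = - (\<Sum>l\<leftarrow>ls. l * ln l) / ln 2"
    using vn_entropy_spectrum[OF A] by metis
  obtain ms where ms: "\<And>l. l \<in> set ms \<Longrightarrow> l \<ge> 0"
    "\<And>t::real. det (1\<^sub>m n + of_real t \<cdot>\<^sub>m B) = of_real (\<Prod>l\<leftarrow>ms. 1 + l * t)"
    "vn_entropy B = - (\<Sum>l\<leftarrow>ms. l * ln l) / ln 2"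
    using vn_entropy_spectrum[OF B] by metis
  have pl: "(\<Prod>l\<leftarrow>ls. 1 + l * t) = 1 + 1 * t + a2 * t\<^sup>2 + a3 * t ^ 3 + a4 * t ^ 4" for t
    using ls(2)[of t] dA[of t] by (metis mult_1 of_real_eq_iff)
  have pm: "(\<Prod>l\<leftarrow>ms. 1 + l * t) = 1 + 1 * t + b2 * t\<^sup>2 + b3 * t ^ 3 + b4 * t ^ 4" for t
    using ms(2)[of t] dB[of t] by (metis mult_1 of_real_eq_iff)
  have "- (\<Sum>l\<leftarrow>ls. l * ln l) \<le> - (\<Sum>m\<leftarrow>ms. m * ln m)"
  proof (rule entropy_mono_spectral_poly[OF ls(1) ms(1)])
    show "sum_list ls = sum_list ms"
      using sum_list_eq_of_prod_affine[OF pl] sum_list_eq_of_prod_affine[OF pm] by simp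
    show "(\<Prod>l\<leftarrow>ls. 1 + l * t) \<le> (\<Prod>m\<leftarrow>ms. 1 + m * t)" if "t > 0" for t
      unfolding pl pm using le that by (intro add_mono mult_right_mono) auto
  qed auto
  then show ?thesis unfolding ls(3) ms(3) by (intro divide_right_mono) auto
qed

text \<open>Monotonicity applied in both directions; this avoids showing that the two lists are
  permutations of each other.\<close>

lemma vn_entropy_eq_of_det:
  assumes A: "A \<in> carrier_mat k k" "nonneg_spectrum A"
    and ms: "\<And>m. m \<in> set ms \<Longrightarrow> m \<ge> 0"
    and dA: "\<And>t::real. det (1\<^sub>m k + of_real t \<cdot>\<^sub>m A) = of_real (\<Prod>m\<leftarrow>ms. 1 + m * t)"
  shows "vn_entropy A = - (\<Sum>m\<leftarrow>ms. m * ln m) / ln 2"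
proof -
  obtain ls where ls: "\<And>l. l \<in> set ls \<Longrightarrow> l \<ge> 0"
    "\<And>t::real. det (1\<^sub>m k + of_real t \<cdot>\<^sub>m A) = of_real (\<Prod>l\<leftarrow>ls. 1 + l * t)"
    "vn_entropy A = - (\<Sum>l\<leftarrow>ls. l * ln l) / ln 2"
    using vn_entropy_spectrum[OF A] by metis
  have eq: "(\<Prod>l\<leftarrow>ls. 1 + l * t) = (\<Prod>m\<leftarrow>ms. 1 + m * t)" for t
    using ls(2)[of t] dA[of t] by (metis of_real_eq_iff)
  have "sum_list ls = sum_list ms"
    using prod_list_affine_deriv_0[of ls] prod_list_affine_deriv_0[of ms] by (simp add: eq DERIV_unique)
  then have "- (\<Sum>l\<leftarrow>ls. l * ln l) = - (\<Sum>m\<leftarrow>ms. m * ln m)"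
    using ls(1) ms eq by (intro antisym entropy_mono_spectral_poly) auto
  then show ?thesis using ls(3) by simp
qed

section \<open>Minors and determinants\<close>

text \<open>Sylvester's determinant identity. Multiplying \<open>?F\<close> by the unitriangular
  \<open>?E\<close> on the right or on the left clears the same off-diagonal block and leaves one of
  the two sides on the diagonal.\<close>

lemma det_one_plus_mult_commute:
  fixes A B :: "'a :: idom mat"
  assumes A: "A \<in> carrier_mat n m" and B: "B \<in> carrier_mat m n"
  shows "det (1\<^sub>m n + A * B) = det (1\<^sub>m m + B * A)"
proof -
  let ?F = "four_block_mat (1\<^sub>m n) (- A) B (1\<^sub>m m)"
  let ?E = "four_block_mat (1\<^sub>m n) A (0\<^sub>m m n) (1\<^sub>m m)"
  have cF: "?F \<in> carrier_mat (n + m) (n + m)" and cE: "?E \<in> carrier_mat (n + m) (n + m)"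
    by (auto intro!: four_block_carrier_mat)
  have dE: "det ?E = 1"
    using A by (subst det_four_block_mat_lower_left_zero[of _ n _ m]) (auto simp: det_one)
  have FE: "?F * ?E = four_block_mat (1\<^sub>m n) (0\<^sub>m n m) B (1\<^sub>m m + B * A)"
    using A B
    by (subst mult_four_block_mat[of _ n n _ m _ m _ _ n _ m]) (auto intro!: cong_four_block_mat simp: comm_add_mat[of _ m m])
  have EF: "?E * ?F = four_block_mat (1\<^sub>m n + A * B) (0\<^sub>m n m) B (1\<^sub>m m)"
    using A B
    by (subst mult_four_block_mat[of _ n n _ m _ m _ _ n _ m]) (auto intro!: cong_four_block_mat)
  have "det ?F = det (?F * ?E)" using det_mult[OF cF cE] dE by simp
  also have "\<dots> = det (1\<^sub>m m + B * A)"
    unfolding FE using A B by (subst det_four_block_mat_upper_right_zero[of _ n _ m]) (auto simp: det_one)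
  finally have 1: "det ?F = det (1\<^sub>m m + B * A)" .
  have "det ?F = det (?E * ?F)" using det_mult[OF cE cF] dE by simp
  also have "\<dots> = det (1\<^sub>m n + A * B)"
    unfolding EF using A B by (subst det_four_block_mat_upper_right_zero[of _ n _ m]) (auto simp: det_one)
  finally show ?thesis using 1 by simp
qed

lemma det_mat_Suc:
  fixes f :: "nat \<Rightarrow> nat \<Rightarrow> 'a :: idom"
  shows "det (mat (Suc n) (Suc n) (\<lambda>(i, j). f i j)) =
    (\<Sum>j<Suc n. f 0 j * ((-1) ^ j * det (mat n n (\<lambda>(i, k). f (Suc i) (if k < j then k else Suc k)))))"
proof -
  have "mat_delete (mat (Suc n) (Suc n) (\<lambda>(i, j). f i j)) 0 j =
      mat n n (\<lambda>(i, k). f (Suc i) (if k < j then k else Suc k))" for j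
    unfolding mat_delete_def by (intro eq_matI) auto
  then show ?thesis
    by (subst laplace_expansion_row[of _ "Suc n" 0]) (auto simp: cofactor_def intro!: sum.cong)
qed

definition minor2 :: "(nat \<Rightarrow> nat \<Rightarrow> 'a :: idom) \<Rightarrow> nat \<Rightarrow> nat \<Rightarrow> nat \<Rightarrow> nat \<Rightarrow> 'a" where
  "minor2 f i j k l = f i k * f j l - f i l * f j k"

definition minor3 :: "(nat \<Rightarrow> nat \<Rightarrow> 'a :: idom) \<Rightarrow> nat \<Rightarrow> nat \<Rightarrow> nat \<Rightarrow> nat \<Rightarrow> nat \<Rightarrow> nat \<Rightarrow> 'a" where
  "minor3 f i j k p q r =
    f i p * (f j q * f k r - f j r * f k q) - f i q * (f j p * f k r - f j r * f k p)
      + f i r * (f j p * f k q - f j q * f k p)"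

definition minor4 :: "(nat \<Rightarrow> nat \<Rightarrow> 'a :: idom) \<Rightarrow> 'a" where
  "minor4 f = f 0 0 * minor3 f 1 2 3 1 2 3 - f 0 1 * minor3 f 1 2 3 0 2 3
    + f 0 2 * minor3 f 1 2 3 0 1 3 - f 0 3 * minor3 f 1 2 3 0 1 2"

lemma det_mat4: "det (mat 4 4 (\<lambda>(i, j). f i j)) = minor4 (f :: nat \<Rightarrow> nat \<Rightarrow> 'a :: idom)"
proof -
  have 4: "(4::nat) = Suc (Suc (Suc (Suc 0)))" by simp
  have d0: "det (mat 0 0 g) = 1" for g :: "nat \<times> nat \<Rightarrow> 'a" by (simp add: det_def)
  show ?thesis
    unfolding 4 det_mat_Suc minor4_def minor3_def
    by (simp add: d0 numeral_2_eq_2 numeral_3_eq_3 algebra_simps)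
qed

lemma det_one_plus_smult_mat4:
  fixes f :: "nat \<Rightarrow> nat \<Rightarrow> 'a :: idom"
  shows "det (1\<^sub>m 4 + t \<cdot>\<^sub>m mat 4 4 (\<lambda>(i, j). f i j)) =
    1 + (f 0 0 + f 1 1 + f 2 2 + f 3 3) * t
      + (minor2 f 0 1 0 1 + minor2 f 0 2 0 2 + minor2 f 0 3 0 3
          + minor2 f 1 2 1 2 + minor2 f 1 3 1 3 + minor2 f 2 3 2 3) * t\<^sup>2
      + (minor3 f 1 2 3 1 2 3 + minor3 f 0 2 3 0 2 3 + minor3 f 0 1 3 0 1 3 + minor3 f 0 1 2 0 1 2) * t ^ 3
      + minor4 f * t ^ 4"
proof -
  have eq: "1\<^sub>m 4 + t \<cdot>\<^sub>m mat 4 4 (\<lambda>(i, j). f i j) = mat 4 4 (\<lambda>(i, j). (if i = j then 1 else 0) + t * f i j)"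
    by (intro eq_matI) auto
  show ?thesis
    unfolding eq det_mat4 by (simp add: minor2_def minor3_def minor4_def) Groebner_Basis.algebra
qed

text \<open>Cauchy-Binet for f = N H^T, here and in the next two lemmas. It separates the minors of
  the first input, weighted by the coefficients of \<open>U\<close>, from those of the second
  input.\<close>

lemma minor2_mult_transpose:
  fixes N H :: "nat \<Rightarrow> nat \<Rightarrow> 'a :: idom"
  assumes "\<And>i l. f i l = N i 0 * H l 0 + N i 1 * H l 1 + N i 2 * H l 2 + N i 3 * H l 3"
  shows "minor2 f i j k l =
    minor2 N i j 0 1 * minor2 H k l 0 1 + minor2 N i j 0 2 * minor2 H k l 0 2
    + minor2 N i j 0 3 * minor2 H k l 0 3 + minor2 N i j 1 2 * minor2 H k l 1 2
    + minor2 N i j 1 3 * minor2 H k l 1 3 + minor2 N i j 2 3 * minor2 H k l 2 3"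
  unfolding minor2_def assms by Groebner_Basis.algebra

lemma minor3_mult_transpose:
  fixes N H :: "nat \<Rightarrow> nat \<Rightarrow> 'a :: idom"
  assumes "\<And>i l. f i l = N i 0 * H l 0 + N i 1 * H l 1 + N i 2 * H l 2 + N i 3 * H l 3"
  shows "minor3 f i j k p q r =
    minor3 N i j k 1 2 3 * minor3 H p q r 1 2 3 + minor3 N i j k 0 2 3 * minor3 H p q r 0 2 3
    + minor3 N i j k 0 1 3 * minor3 H p q r 0 1 3 + minor3 N i j k 0 1 2 * minor3 H p q r 0 1 2"
  unfolding minor3_def assms by Groebner_Basis.algebra

lemma minor4_mult_transpose:
  fixes N H :: "nat \<Rightarrow> nat \<Rightarrow> 'a :: idom"
  assumes "\<And>i l. f i l = N i 0 * H l 0 + N i 1 * H l 1 + N i 2 * H l 2 + N i 3 * H l 3"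
  shows "minor4 f = minor4 N * minor4 H"
proof -
  let ?N = "mat 4 4 (\<lambda>(i, j). N i j)" and ?H = "mat 4 4 (\<lambda>(i, j). H i j)"
  have 4: "{0..<4::nat} = {0, 1, 2, 3}" by auto
  have eq: "mat 4 4 (\<lambda>(i, j). f i j) = ?N * transpose_mat ?H"
    by (intro eq_matI) (auto simp: assms scalar_prod_def 4)
  have "det (mat 4 4 (\<lambda>(i, j). f i j)) = det ?N * det (transpose_mat ?H)"
    unfolding eq by (rule det_mult[of _ 4]) auto
  then show ?thesis by (simp add: det_mat4 det_transpose[of _ 4])
qed

section \<open>Gram matrices of Pauli orbits\<close>

text \<open>The Gram matrix of the four vectors \<open>\<sigma>\<^sub>j \<phi>\<close>, where \<open>(a1, a2, a3)\<close> is the Bloch vector of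
  the reduced state of \<open>\<phi>\<close> on the qubit.\<close>

definition pauli_gram :: "complex \<Rightarrow> complex \<Rightarrow> complex \<Rightarrow> nat \<Rightarrow> nat \<Rightarrow> complex" where
  "pauli_gram a1 a2 a3 j k =
    [[1, a1, a2, a3],
     [a1, 1, - \<i> * a3, \<i> * a2],
     [a2, \<i> * a3, 1, - \<i> * a1],
     [a3, - \<i> * a2, \<i> * a1, 1]] ! j ! k"

lemma pauli_gram_simps:
  "pauli_gram a1 a2 a3 0 0 = 1" "pauli_gram a1 a2 a3 0 1 = a1"
  "pauli_gram a1 a2 a3 0 2 = a2" "pauli_gram a1 a2 a3 0 3 = a3"
  "pauli_gram a1 a2 a3 1 0 = a1" "pauli_gram a1 a2 a3 1 1 = 1"
  "pauli_gram a1 a2 a3 1 2 = - \<i> * a3" "pauli_gram a1 a2 a3 1 3 = \<i> * a2"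
  "pauli_gram a1 a2 a3 2 0 = a2" "pauli_gram a1 a2 a3 2 1 = \<i> * a3"
  "pauli_gram a1 a2 a3 2 2 = 1" "pauli_gram a1 a2 a3 2 3 = - \<i> * a1"
  "pauli_gram a1 a2 a3 3 0 = a3" "pauli_gram a1 a2 a3 3 1 = - \<i> * a2"
  "pauli_gram a1 a2 a3 3 2 = \<i> * a1" "pauli_gram a1 a2 a3 3 3 = 1"
  by (simp_all add: pauli_gram_def numeral_2_eq_2 numeral_3_eq_3)

text \<open>The matrices \<open>\<sigma>\<close>_j / sqrt 2 form an orthonormal basis, so for a real
  Bloch vector this Gram matrix is unitarily equivalent to twice the reduced qubit state tensored
  with the identity. Its eigenvalues are 1 + |a| and 1 - |a|, each twice.\<close>

lemma minor4_pauli_gram: "minor4 (pauli_gram a1 a2 a3) = (1 - a1\<^sup>2 - a2\<^sup>2 - a3\<^sup>2)\<^sup>2"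
proof -
  have "\<i> * \<i> = -1" by simp
  then show ?thesis unfolding minor4_def minor3_def pauli_gram_simps by Groebner_Basis.algebra
qed

text \<open>Since (g - 1)^2 = |a|^2, g (2 - g) = \<open>\<alpha>\<close>. As det g =
  \<open>\<alpha>\<close>^2, the adjugate of g is \<open>\<alpha>\<close> (2 - g); the table lists
  its transposed entries without the cofactor signs.\<close>

lemma minor3_pauli_gram:
  fixes a1 a2 a3 :: complex
  defines "g \<equiv> pauli_gram a1 a2 a3" and "\<alpha> \<equiv> 1 - a1\<^sup>2 - a2\<^sup>2 - a3\<^sup>2"
  shows "minor3 g 1 2 3 1 2 3 = \<alpha>" "minor3 g 1 2 3 0 2 3 = \<alpha> * a1"
    "minor3 g 1 2 3 0 1 3 = - \<alpha> * a2" "minor3 g 1 2 3 0 1 2 = \<alpha> * a3"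
    "minor3 g 0 2 3 1 2 3 = \<alpha> * a1" "minor3 g 0 2 3 0 2 3 = \<alpha>"
    "minor3 g 0 2 3 0 1 3 = \<alpha> * \<i> * a3" "minor3 g 0 2 3 0 1 2 = \<alpha> * \<i> * a2"
    "minor3 g 0 1 3 1 2 3 = - \<alpha> * a2" "minor3 g 0 1 3 0 2 3 = - \<alpha> * \<i> * a3"
    "minor3 g 0 1 3 0 1 3 = \<alpha>" "minor3 g 0 1 3 0 1 2 = \<alpha> * \<i> * a1"
    "minor3 g 0 1 2 1 2 3 = \<alpha> * a3" "minor3 g 0 1 2 0 2 3 = - \<alpha> * \<i> * a2"
    "minor3 g 0 1 2 0 1 3 = - \<alpha> * \<i> * a1" "minor3 g 0 1 2 0 1 2 = \<alpha>"
proof -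
  have "\<i> * \<i> = -1" by simp
  show "minor3 g 1 2 3 1 2 3 = \<alpha>" "minor3 g 1 2 3 0 2 3 = \<alpha> * a1"
    "minor3 g 1 2 3 0 1 3 = - \<alpha> * a2" "minor3 g 1 2 3 0 1 2 = \<alpha> * a3"
    "minor3 g 0 2 3 1 2 3 = \<alpha> * a1" "minor3 g 0 2 3 0 2 3 = \<alpha>"
    "minor3 g 0 2 3 0 1 3 = \<alpha> * \<i> * a3" "minor3 g 0 2 3 0 1 2 = \<alpha> * \<i> * a2"
    "minor3 g 0 1 3 1 2 3 = - \<alpha> * a2" "minor3 g 0 1 3 0 2 3 = - \<alpha> * \<i> * a3"
    "minor3 g 0 1 3 0 1 3 = \<alpha>" "minor3 g 0 1 3 0 1 2 = \<alpha> * \<i> * a1"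
    "minor3 g 0 1 2 1 2 3 = \<alpha> * a3" "minor3 g 0 1 2 0 2 3 = - \<alpha> * \<i> * a2"
    "minor3 g 0 1 2 0 1 3 = - \<alpha> * \<i> * a1" "minor3 g 0 1 2 0 1 2 = \<alpha>"
    using \<open>\<i> * \<i> = -1\<close>
    unfolding g_def \<alpha>_def minor3_def pauli_gram_simps by Groebner_Basis.algebra+
qed

text \<open>The second compound of \<open>pauli_gram\<close> splits into a self-dual and an anti-self-dual part, which
  is why only \<open>u u'\<close> and \<open>v v'\<close> products occur on the right.\<close>

lemma pauli_gram_minor2_sum:
  fixes a1 a2 a3 b1 b2 b3 c0 c1 c2 d0 d1 d2 :: complex
  defines "N \<equiv> pauli_gram a1 a2 a3" and "H \<equiv> pauli_gram b1 b2 b3"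
  defines "\<alpha> \<equiv> 1 - a1\<^sup>2 - a2\<^sup>2 - a3\<^sup>2" and "\<beta> \<equiv> 1 - b1\<^sup>2 - b2\<^sup>2 - b3\<^sup>2"
  defines "u1 \<equiv> c0 * c1 + c2 * c2" and "u1' \<equiv> d0 * d1 + d2 * d2"
    and "u2 \<equiv> c0 * c2 + c1 * c2" and "u2' \<equiv> d0 * d2 + d1 * d2"
    and "v1 \<equiv> c0 * c1 - c2 * c2" and "v1' \<equiv> d0 * d1 - d2 * d2"
    and "v2 \<equiv> c0 * c2 - c1 * c2" and "v2' \<equiv> d0 * d2 - d1 * d2"
  shows "4 * (\<Sum>(p, q) \<leftarrow> [(0, 1), (0, 2), (0, 3), (1, 2), (1, 3), (2, 3)].
     \<Sum>(r, s) \<leftarrow> [(0, 1), (0, 2), (0, 3), (1, 2), (1, 3), (2, 3)].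
      [c0, c1, c2, c2] ! p * [c0, c1, c2, c2] ! q * ([d0, d1, d2, d2] ! r * [d0, d1, d2, d2] ! s)
        * minor2 N p q r s * minor2 H p q r s) =
    u1 * u1' * (\<alpha> * (1 - b1\<^sup>2 + b2\<^sup>2 + b3\<^sup>2) + \<beta> * (1 - a1\<^sup>2 + a2\<^sup>2 + a3\<^sup>2))
    + 2 * (u2 * u2') * (\<alpha> * (1 + b1\<^sup>2) + \<beta> * (1 + a1\<^sup>2))
    + v1 * v1' * (\<alpha> * \<beta> + (1 - a1\<^sup>2 + a2\<^sup>2 + a3\<^sup>2) * (1 - b1\<^sup>2 + b2\<^sup>2 + b3\<^sup>2))
    + v2 * v2' * (2 * \<alpha> * \<beta> + (1 + a1\<^sup>2 - a2\<^sup>2 + a3\<^sup>2) * (1 + b1\<^sup>2 - b2\<^sup>2 + b3\<^sup>2)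
       + (1 + a1\<^sup>2 + a2\<^sup>2 - a3\<^sup>2) * (1 + b1\<^sup>2 + b2\<^sup>2 - b3\<^sup>2) + 8 * (a2 * a3 * b2 * b3 - a1 * b1))
    + 4 * (v1 * v2' + v2 * v1') * ((a1 * b1 - 1) * (a2 * b2 + a3 * b3))
    + 4 * (\<i> * (v1 * v2' - v2 * v1')) * ((a1 - b1) * (a2 * b3 - a3 * b2))"
proof -
  have i: "\<i> * \<i> = -1" by simp
  show ?thesis
    unfolding assms
    by (simp add: minor2_def pauli_gram_simps numeral_2_eq_2[symmetric] numeral_3_eq_3[symmetric]
       pauli_gram_simps[unfolded One_nat_def]) (use i in Groebner_Basis.algebra)
qed

section \<open>The reduced output state\<close>

definition pauli_act :: "(nat \<Rightarrow> nat \<Rightarrow> complex) \<Rightarrow> nat \<Rightarrow> nat \<Rightarrow> nat \<Rightarrow> complex" where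
  "pauli_act \<phi> j a r = (\<Sum>a'<2. pauli j a a' * \<phi> a' r)"

definition gram :: "nat \<Rightarrow> (nat \<Rightarrow> nat \<Rightarrow> complex) \<Rightarrow> nat \<Rightarrow> nat \<Rightarrow> complex" where
  "gram m \<phi> j k = (\<Sum>a<2. \<Sum>r<m. pauli_act \<phi> j a r * cnj (pauli_act \<phi> k a r))"

lemma lessThan_2_nat: "{..<2::nat} = {0, 1}" by auto
lemma lessThan_4_nat: "{..<4::nat} = {0, 1, 2, 3}" by auto

lemma out_amp_eq:
  "out_amp x y z \<phi> \<psi> a b r s = (\<Sum>j<4. coef x y z j * pauli_act \<phi> j a r * pauli_act \<psi> j b s)"
  unfolding out_amp_def Uent_def pauli_act_def lessThan_2_nat lessThan_4_nat
  by (simp add: algebra_simps)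

lemma sum_div_mod:
  fixes F :: "nat \<Rightarrow> nat \<Rightarrow> 'a :: comm_monoid_add"
  assumes "n > 0"
  shows "(\<Sum>i<2 * n. F (i div n) (i mod n)) = (\<Sum>b<2. \<Sum>s<n. F b s)"
proof -
  have "b * n + s < 2 * n" if "b < 2" "s < n" for b s
    using that by (cases "b = 0") (auto simp: less_2_cases_iff)
  then have "(\<Sum>i<2 * n. F (i div n) (i mod n)) = (\<Sum>(b, s)\<in>{..<2} \<times> {..<n}. F b s)"
    by (intro sum.reindex_bij_witness[of _ "\<lambda>(b, s). b * n + s" "\<lambda>i. (i div n, i mod n)"])
      (use assms in \<open>auto simp: less_mult_imp_div_less\<close>)
  then show ?thesis by (simp add: sum.cartesian_product)
qed

text \<open>The reduced state factors through the four values of the Pauli index, so its rank is at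
  most four whatever the ancillas are.\<close>

lemma reduced_out_amp_factor:
  fixes x y z :: real
  defines "c \<equiv> coef x y z"
  shows "reduced_BR m n (out_amp x y z \<phi> \<psi>) =
    mat (2 * n) 4 (\<lambda>(i, j). pauli_act \<psi> j (i div n) (i mod n)) *
    mat 4 (2 * n) (\<lambda>(j, i). \<Sum>k<4. c j * cnj (c k) * gram m \<phi> j k * cnj (pauli_act \<psi> k (i div n) (i mod n)))"
    (is "_ = ?A * ?B")
proof (rule eq_matI)
  fix i k assume "i < dim_row (?A * ?B)" "k < dim_col (?A * ?B)"
  then have ik: "i < 2 * n" "k < 2 * n" by auto
  let ?p = "\<lambda>j. pauli_act \<psi> j (i div n) (i mod n)" and ?q = "\<lambda>j. pauli_act \<psi> j (k div n) (k mod n)"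
  have "reduced_BR m n (out_amp x y z \<phi> \<psi>) $$ (i, k) =
     (\<Sum>a<2. \<Sum>r<m. (\<Sum>j<4. c j * pauli_act \<phi> j a r * ?p j) * cnj (\<Sum>j<4. c j * pauli_act \<phi> j a r * ?q j))"
    using ik by (simp add: reduced_BR_def out_amp_eq c_def)
  also have "\<dots> = (\<Sum>a<2. \<Sum>r<m. \<Sum>j<4. \<Sum>l<4.
      ?p j * (c j * cnj (c l) * (pauli_act \<phi> j a r * cnj (pauli_act \<phi> l a r)) * cnj (?q l)))"
    by (simp add: sum_product mult_ac)
  also have "\<dots> = (\<Sum>j<4. \<Sum>l<4. \<Sum>a<2. \<Sum>r<m.
      ?p j * (c j * cnj (c l) * (pauli_act \<phi> j a r * cnj (pauli_act \<phi> l a r)) * cnj (?q l)))"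
    by (simp add: sum.swap[of _ "{..<m}" "{..<4}"] sum.swap[of _ "{..<2}" "{..<4}"])
  also have "\<dots> = (\<Sum>j<4. ?p j * (\<Sum>l<4. c j * cnj (c l) * gram m \<phi> j l * cnj (?q l)))"
    by (simp add: gram_def sum_distrib_left sum_distrib_right)
  also have "\<dots> = (?A * ?B) $$ (i, k)"
    using ik by (simp add: scalar_prod_def atLeast0LessThan)
  finally show "reduced_BR m n (out_amp x y z \<phi> \<psi>) $$ (i, k) = (?A * ?B) $$ (i, k)" .
qed (auto simp: reduced_BR_def)

text \<open>Swapping the two factors by Sylvester's identity eliminates the ancilla dimensions: the
  inputs survive only through their Gram matrices.\<close>

lemma det_reduced_out_amp:
  fixes x y z :: real
  assumes n: "n > 0"
  defines "c \<equiv> coef x y z"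
  shows "det (1\<^sub>m (2 * n) + t \<cdot>\<^sub>m reduced_BR m n (out_amp x y z \<phi> \<psi>)) =
    det (1\<^sub>m 4 + t \<cdot>\<^sub>m mat 4 4 (\<lambda>(j, l). \<Sum>k<4. c j * cnj (c k) * gram m \<phi> j k * gram n \<psi> l k))"
proof -
  let ?A = "mat (2 * n) 4 (\<lambda>(i, j). pauli_act \<psi> j (i div n) (i mod n))"
  let ?B = "mat 4 (2 * n) (\<lambda>(j, i). \<Sum>k<4. c j * cnj (c k) * gram m \<phi> j k * cnj (pauli_act \<psi> k (i div n) (i mod n)))"
  have "t \<cdot>\<^sub>m (?A * ?B) = ?A * (t \<cdot>\<^sub>m ?B)" by (rule mult_smult_distrib[symmetric]) auto
  moreover have "(t \<cdot>\<^sub>m ?B) * ?A = t \<cdot>\<^sub>m (?B * ?A)" by (rule mult_smult_assoc_mat) auto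
  moreover have "det (1\<^sub>m (2 * n) + ?A * (t \<cdot>\<^sub>m ?B)) = det (1\<^sub>m 4 + (t \<cdot>\<^sub>m ?B) * ?A)"
    by (rule det_one_plus_mult_commute) auto
  moreover have "?B * ?A = mat 4 4 (\<lambda>(j, l). \<Sum>k<4. c j * cnj (c k) * gram m \<phi> j k * gram n \<psi> l k)"
  proof (rule eq_matI)
    fix j l assume "j < dim_row (mat 4 4 (\<lambda>(j, l). \<Sum>k<4. c j * cnj (c k) * gram m \<phi> j k * gram n \<psi> l k))"
      "l < dim_col (mat 4 4 (\<lambda>(j, l). \<Sum>k<4. c j * cnj (c k) * gram m \<phi> j k * gram n \<psi> l k))"
    then have jl: "j < 4" "l < 4" by auto
    have "(?B * ?A) $$ (j, l) = (\<Sum>i<2 * n. (\<Sum>k<4. c j * cnj (c k) * gram m \<phi> j k * cnj (pauli_act \<psi> k (i div n) (i mod n)))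
        * pauli_act \<psi> l (i div n) (i mod n))"
      using jl by (simp add: scalar_prod_def atLeast0LessThan)
    also have "\<dots> = (\<Sum>k<4. c j * cnj (c k) * gram m \<phi> j k *
        (\<Sum>i<2 * n. pauli_act \<psi> l (i div n) (i mod n) * cnj (pauli_act \<psi> k (i div n) (i mod n))))"
      by (simp add: sum_distrib_left sum_distrib_right mult_ac) (rule sum.swap)
    also have "\<dots> = (\<Sum>k<4. c j * cnj (c k) * gram m \<phi> j k * gram n \<psi> l k)"
      by (simp add: gram_def sum_div_mod[OF n, of "\<lambda>b s. pauli_act \<psi> l b s * cnj (pauli_act \<psi> k b s)" for k])
    finally show "(?B * ?A) $$ (j, l) = mat 4 4 (\<lambda>(j, l). \<Sum>k<4. c j * cnj (c k) * gram m \<phi> j k * gram n \<psi> l k) $$ (j, l)"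
      using jl by simp
  qed auto
  ultimately show ?thesis unfolding reduced_out_amp_factor c_def by simp
qed

text \<open>For an eigenvector v the number v* \<open>\<rho>\<close> v is both \<open>ev\<close>
  times the squared norm of v and a sum of squared moduli over the traced-out indices.\<close>

lemma nonneg_spectrum_reduced_BR: "nonneg_spectrum (reduced_BR m n \<Psi>)"
  unfolding nonneg_spectrum_def
proof (intro allI impI)
  fix ev assume "eigenvalue (reduced_BR m n \<Psi>) ev"
  then obtain v where v: "eigenvector (reduced_BR m n \<Psi>) v ev" by (auto simp: eigenvalue_def)
  let ?\<Psi> = "\<lambda>a r i. \<Psi> a (i div n) r (i mod n)"
  have dim: "dim_row (reduced_BR m n \<Psi>) = 2 * n" by (simp add: reduced_BR_def)
  have vc: "v \<in> carrier_vec (2 * n)" "v \<noteq> 0\<^sub>v (2 * n)"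
    and ev: "reduced_BR m n \<Psi> *\<^sub>v v = ev \<cdot>\<^sub>v v"
    using v unfolding eigenvector_def dim by auto
  have comp: "(\<Sum>k<2 * n. (\<Sum>a<2. \<Sum>r<m. ?\<Psi> a r i * cnj (?\<Psi> a r k)) * v $ k) = ev * v $ i" if "i < 2 * n" for i
  proof -
    have "(reduced_BR m n \<Psi> *\<^sub>v v) $ i = (ev \<cdot>\<^sub>v v) $ i" using ev by simp
    then show ?thesis using that vc by (simp add: reduced_BR_def scalar_prod_def atLeast0LessThan)
  qed
  have "ev * of_real (\<Sum>i<2 * n. (cmod (v $ i))\<^sup>2) = (\<Sum>i<2 * n. cnj (v $ i) * (ev * v $ i))"
    unfolding of_real_sum sum_distrib_left by (intro sum.cong refl) (simp only: complex_norm_square mult_ac)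
  also have "\<dots> = (\<Sum>i<2 * n. cnj (v $ i) * (\<Sum>k<2 * n. (\<Sum>a<2. \<Sum>r<m. ?\<Psi> a r i * cnj (?\<Psi> a r k)) * v $ k))"
    by (intro sum.cong) (auto simp: comp)
  also have "\<dots> = (\<Sum>a<2. \<Sum>r<m. (\<Sum>i<2 * n. cnj (v $ i) * ?\<Psi> a r i) * cnj (\<Sum>k<2 * n. cnj (v $ k) * ?\<Psi> a r k))"
    by (simp add: sum_product sum_distrib_left sum_distrib_right mult_ac)
      (simp add: sum.swap[of _ "{..<n * 2}" "{..<m}"] sum.swap[of _ "{..<n * 2}" "{..<2::nat}"])
  also have "\<dots> = of_real (\<Sum>a<2. \<Sum>r<m. (cmod (\<Sum>i<2 * n. cnj (v $ i) * ?\<Psi> a r i))\<^sup>2)"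
    unfolding of_real_sum by (simp only: complex_norm_square)
  finally have eq: "ev * of_real (\<Sum>i<2 * n. (cmod (v $ i))\<^sup>2) =
      of_real (\<Sum>a<2. \<Sum>r<m. (cmod (\<Sum>i<2 * n. cnj (v $ i) * ?\<Psi> a r i))\<^sup>2)" (is "ev * of_real ?V = of_real ?W") .
  have "?V > 0"
  proof -
    obtain i where i: "i < 2 * n" "v $ i \<noteq> 0" using vc by (metis carrier_vecD eq_vecI index_zero_vec(1) zero_carrier_vec)
    then show ?thesis by (intro sum_pos2[of _ i]) auto
  qed
  moreover have "?W \<ge> 0" by (intro sum_nonneg) auto
  moreover have "ev = of_real (?W / ?V)"
    using eq \<open>?V > 0\<close> by (simp add: field_simps del: of_real_sum)
  ultimately show "Im ev = 0 \<and> Re ev \<ge> 0" by simp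
qed

section \<open>Bloch vectors and the coefficients of the determinant\<close>

definition bloch1 :: "nat \<Rightarrow> (nat \<Rightarrow> nat \<Rightarrow> complex) \<Rightarrow> real" where
  "bloch1 m \<phi> = 2 * Re (\<Sum>r<m. \<phi> 0 r * cnj (\<phi> 1 r))"
definition bloch2 :: "nat \<Rightarrow> (nat \<Rightarrow> nat \<Rightarrow> complex) \<Rightarrow> real" where
  "bloch2 m \<phi> = - 2 * Im (\<Sum>r<m. \<phi> 0 r * cnj (\<phi> 1 r))"
definition bloch3 :: "nat \<Rightarrow> (nat \<Rightarrow> nat \<Rightarrow> complex) \<Rightarrow> real" where
  "bloch3 m \<phi> = (\<Sum>r<m. (cmod (\<phi> 0 r))\<^sup>2) - (\<Sum>r<m. (cmod (\<phi> 1 r))\<^sup>2)"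

lemma gram_eq_pauli_gram:
  assumes "unit_state m \<phi>" "j < 4" "k < 4"
  shows "gram m \<phi> j k = pauli_gram (bloch1 m \<phi>) (bloch2 m \<phi>) (bloch3 m \<phi>) j k"
proof -
  define S where "S a b = (\<Sum>r<m. \<phi> a r * cnj (\<phi> b r))" for a b
  \<comment> \<open>Each Pauli matrix permutes the two basis vectors (\<open>f\<close>) and
    multiplies them by phases (\<open>p\<close>).\<close>
  define f where "f j a = (if j = 1 \<or> j = 2 then 1 - a else a)" for j a :: nat
  define p where "p j a = (if j = 2 then (if a = 0 then - \<i> else \<i>) else if j = 3 \<and> a = 1 then -1 else 1)"
    for j a :: nat
  have act: "pauli_act \<phi> j a r = p j a * \<phi> (f j a) r" if "a = 0 \<or> a = 1" "j < 4" for j a r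
    using that by (auto simp: pauli_act_def lessThan_2_nat pauli_def p_def f_def)
  have gr: "gram m \<phi> j k = (\<Sum>a\<in>{0, 1}. p j a * cnj (p k a) * S (f j a) (f k a))"
    unfolding gram_def lessThan_2_nat S_def sum_distrib_left
    by (intro sum.cong refl) (use act assms in auto)
  have S10: "S 1 0 = cnj (S 0 1)" by (simp add: S_def mult.commute)
  have b1: "of_real (bloch1 m \<phi>) = S 0 1 + S 1 0" "of_real (bloch2 m \<phi>) = \<i> * (S 0 1 - S 1 0)"
    unfolding bloch1_def bloch2_def S10 S_def[symmetric] by (simp_all add: complex_eq_iff)
  have uw: "S 0 0 = of_real (\<Sum>r<m. (cmod (\<phi> 0 r))\<^sup>2)" "S 1 1 = of_real (\<Sum>r<m. (cmod (\<phi> 1 r))\<^sup>2)"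
    unfolding S_def of_real_sum by (simp_all only: complex_norm_square)
  have b3: "of_real (bloch3 m \<phi>) = S 0 0 - S 1 1" unfolding bloch3_def uw by simp
  have one: "1 = S 0 0 + S 1 1"
    using assms(1) unfolding unit_state_def uw lessThan_2_nat
    by (simp del: of_real_sum add: of_real_add[symmetric])
  have n: "j \<in> {0, 1, 2, 3}" "k \<in> {0, 1, 2, 3}" using assms(2,3) by auto
  have sums: "(\<Sum>a\<in>{0, 1::nat}. h a) = h 0 + h 1" for h :: "nat \<Rightarrow> complex" by simp
  have ii: "\<i> * \<i> = -1" by simp
  show ?thesis
    using n unfolding gr sums
    by (elim insertE emptyE; hypsubst; simp only: pauli_gram_simps b1 b3; (subst one)?;
        simp add: p_def f_def algebra_simps)
qed

text \<open>1 - |a|^2 is four times the determinant u w - |X|^2 of the reduced qubit state,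
  nonnegative by Cauchy-Schwarz.\<close>

lemma bloch_norm_le:
  assumes "unit_state m \<phi>"
  shows "(bloch1 m \<phi>)\<^sup>2 + (bloch2 m \<phi>)\<^sup>2 + (bloch3 m \<phi>)\<^sup>2 \<le> 1"
proof -
  define X where "X = (\<Sum>r<m. \<phi> 0 r * cnj (\<phi> 1 r))"
  define u where "u = (\<Sum>r<m. (cmod (\<phi> 0 r))\<^sup>2)"
  define w where "w = (\<Sum>r<m. (cmod (\<phi> 1 r))\<^sup>2)"
  have "cmod X \<le> (\<Sum>r<m. cmod (\<phi> 0 r) * cmod (\<phi> 1 r))"
    unfolding X_def by (rule order.trans[OF norm_sum]) (simp add: norm_mult)
  then have "(cmod X)\<^sup>2 \<le> (\<Sum>r<m. cmod (\<phi> 0 r) * cmod (\<phi> 1 r))\<^sup>2"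
    by (intro power_mono) auto
  also have "\<dots> \<le> u * w" unfolding u_def w_def by (rule Cauchy_Schwarz_ineq_sum)
  finally have le: "(Re X)\<^sup>2 + (Im X)\<^sup>2 \<le> u * w" by (simp add: cmod_power2)
  have one: "u + w = 1" using assms by (simp add: unit_state_def lessThan_2_nat u_def w_def)
  have "(bloch1 m \<phi>)\<^sup>2 + (bloch2 m \<phi>)\<^sup>2 + (bloch3 m \<phi>)\<^sup>2 = 4 * ((Re X)\<^sup>2 + (Im X)\<^sup>2) + (u - w)\<^sup>2"
    unfolding bloch1_def bloch2_def bloch3_def X_def u_def w_def by (simp add: power2_eq_square algebra_simps)
  also have "\<dots> \<le> 4 * (u * w) + (u - w)\<^sup>2" using le by simp
  also have "\<dots> = (u + w)\<^sup>2" by (simp add: power2_eq_square algebra_simps)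
  finally show ?thesis using one by simp
qed

lemma coef_mult_cnj:
  fixes x y :: real
  defines "\<omega> \<equiv> Complex (cos (2 * x)) (sin (2 * x))" and "c \<equiv> of_real (cos (2 * y))" and "s \<equiv> of_real (sin (2 * y))"
  assumes "j < 4" "k < 4"
  shows "coef x y y j * cnj (coef x y y k) =
    [(\<omega> + c) / 2, (\<omega> - c) / 2, \<i> * s / 2, \<i> * s / 2] ! j *
    [(cnj \<omega> + c) / 2, (cnj \<omega> - c) / 2, - \<i> * s / 2, - \<i> * s / 2] ! k"
proof -
  \<comment> \<open>The common phase exp (-i x) of all four coefficients, which cancels against its
    conjugate.\<close>
  define p where "p = Complex (cos x) (- sin x)"
  have pp: "p * cnj p = 1" by (simp add: p_def complex_eq_iff flip: power2_eq_square)
  have cy: "cos y * cos y = (1 + cos (2 * y)) / 2" "sin y * sin y = (1 - cos (2 * y)) / 2"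
    using sin_cos_squared_add[of y] by (simp_all add: cos_double power2_eq_square)
  have eq: "coef x y y j = p * [(\<omega> + c) / 2, (\<omega> - c) / 2, \<i> * s / 2, \<i> * s / 2] ! j" if "j < 4" for j
  proof -
    have "cos x * cos (2 * x) + sin x * sin (2 * x) = cos x"
      "cos x * sin (2 * x) - sin x * cos (2 * x) = sin x"
      using cos_diff[of "2 * x" x] sin_diff[of "2 * x" x] by (simp_all add: algebra_simps)
    then have "p * \<omega> = Complex (cos x) (sin x)"
      by (simp add: p_def \<omega>_def complex_eq_iff)
    moreover have "coef x y y 0 = (Complex (cos x) (sin x) + p * c) / 2"
      "coef x y y 1 = (Complex (cos x) (sin x) - p * c) / 2"
      "coef x y y 2 = p * (\<i> * s / 2)" "coef x y y 3 = p * (\<i> * s / 2)"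
      by (simp_all add: coef_def p_def c_def s_def complex_eq_iff mult.assoc cy sin_double) (simp_all add: algebra_simps)
    moreover have "j \<in> {0, 1, 2, 3}" using that by auto
    ultimately show ?thesis
      by (elim insertE emptyE; hypsubst) (simp_all add: algebra_simps numeral_2_eq_2[symmetric] numeral_3_eq_3[symmetric] add_divide_distrib diff_divide_distrib)
  qed
  have w: "cnj c = c" "cnj s = s" by (simp_all add: c_def s_def)
  have eq': "cnj (coef x y y k) = cnj p * [(cnj \<omega> + c) / 2, (cnj \<omega> - c) / 2, - \<i> * s / 2, - \<i> * s / 2] ! k"
  proof -
    have "k \<in> {0, 1, 2, 3}" using assms by auto
    then show ?thesis unfolding eq[OF assms(5)] by (auto simp: w)
  qed
  have "coef x y y j * cnj (coef x y y k) = (p * cnj p) *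
    ([(\<omega> + c) / 2, (\<omega> - c) / 2, \<i> * s / 2, \<i> * s / 2] ! j *
    [(cnj \<omega> + c) / 2, (cnj \<omega> - c) / 2, - \<i> * s / 2, - \<i> * s / 2] ! k)"
    unfolding eq[OF assms(4)] eq' by (simp only: mult_ac)
  then show ?thesis unfolding pp by simp
qed

text \<open>The coefficients of \<open>t\<^sup>2\<close>, \<open>t\<^sup>3\<close>, \<open>t\<^sup>4\<close> in \<open>det (1 + t \<rho>)\<close> for inputs with Bloch vectors \<open>a\<close>, \<open>b\<close>. Here
  \<open>q = sin\<^sup>2 2y\<close>, \<open>t = sin\<^sup>2 2x\<close>, \<open>W = sin 2x cos 2x sin 2y cos 2y\<close> and \<open>J = sin 2y cos 2y (t - q)\<close>.\<close>

definition coeff2 :: "real \<Rightarrow> real \<Rightarrow> real \<Rightarrow> real \<Rightarrow> real \<Rightarrow> real \<Rightarrow> real \<Rightarrow> real \<Rightarrow> real \<Rightarrow> real \<Rightarrow> real" where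
  "coeff2 q t W J a1 a2 a3 b1 b2 b3 = (let \<alpha> = 1 - a1\<^sup>2 - a2\<^sup>2 - a3\<^sup>2; \<beta> = 1 - b1\<^sup>2 - b2\<^sup>2 - b3\<^sup>2 in
    (t * (\<alpha> * (1 - b1\<^sup>2 + b2\<^sup>2 + b3\<^sup>2) + \<beta> * (1 - a1\<^sup>2 + a2\<^sup>2 + a3\<^sup>2))
    + 2 * q * (\<alpha> * (1 + b1\<^sup>2) + \<beta> * (1 + a1\<^sup>2))
    + (q\<^sup>2 + t * (1 - 2 * q)) * (\<alpha> * \<beta> + (1 - a1\<^sup>2 + a2\<^sup>2 + a3\<^sup>2) * (1 - b1\<^sup>2 + b2\<^sup>2 + b3\<^sup>2))
    + q * (1 - q) * (2 * \<alpha> * \<beta> + (1 + a1\<^sup>2 - a2\<^sup>2 + a3\<^sup>2) * (1 + b1\<^sup>2 - b2\<^sup>2 + b3\<^sup>2)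
       + (1 + a1\<^sup>2 + a2\<^sup>2 - a3\<^sup>2) * (1 + b1\<^sup>2 + b2\<^sup>2 - b3\<^sup>2) + 8 * (a2 * a3 * b2 * b3 - a1 * b1))
    + 8 * W * ((a1 * b1 - 1) * (a2 * b2 + a3 * b3))
    - 8 * J * ((a1 - b1) * (a2 * b3 - a3 * b2))) / 16)"

definition coeff3 :: "real \<Rightarrow> real \<Rightarrow> real \<Rightarrow> real \<Rightarrow> real \<Rightarrow> real \<Rightarrow> real \<Rightarrow> real \<Rightarrow> real \<Rightarrow> real" where
  "coeff3 q t W a1 a2 a3 b1 b2 b3 = (1 - a1\<^sup>2 - a2\<^sup>2 - a3\<^sup>2) * (1 - b1\<^sup>2 - b2\<^sup>2 - b3\<^sup>2) *
    (q * (q + 2 * ((1 - q) * t) - 2 * ((1 - q) * t) * (a1 * b1) - 2 * W * (a2 * b2 + a3 * b3)) / 16)"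

definition coeff4 :: "real \<Rightarrow> real \<Rightarrow> real \<Rightarrow> real \<Rightarrow> real \<Rightarrow> real \<Rightarrow> real \<Rightarrow> real \<Rightarrow> real" where
  "coeff4 q t a1 a2 a3 b1 b2 b3 = ((1 - a1\<^sup>2 - a2\<^sup>2 - a3\<^sup>2) * (1 - b1\<^sup>2 - b2\<^sup>2 - b3\<^sup>2))\<^sup>2 *
    (q\<^sup>2 * (q\<^sup>2 + 4 * ((1 - q) * t)) / 256)"

text \<open>Up to a global phase the coefficients of \<open>U\<close> are \<open>(w + c) / 2\<close>, \<open>(w - c) / 2\<close>, \<open>\<i> s / 2\<close>, \<open>\<i> s / 2\<close> with
  \<open>w = exp (2 \<i> x)\<close>, \<open>c = cos 2y\<close> and \<open>s = sin 2y\<close>.\<close>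

lemma coef_products:
  fixes C S c s w w' :: complex
  assumes w: "w = C + \<i> * S" "w' = C - \<i> * S" and C: "C\<^sup>2 + S\<^sup>2 = 1" and c: "c\<^sup>2 + s\<^sup>2 = 1"
  defines "c0 \<equiv> (w + c) / 2" and "c1 \<equiv> (w - c) / 2" and "c2 \<equiv> \<i> * s / 2"
    and "d0 \<equiv> (w' + c) / 2" and "d1 \<equiv> (w' - c) / 2" and "d2 \<equiv> - \<i> * s / 2"
  shows "c0 * d0 + c1 * d1 + 2 * (c2 * d2) = 1"
    "c0 * d1 + c1 * d0 = 2 * (c2 * d2)"
    "c0 * d2 + c2 * d0 = c1 * d2 + c2 * d1"
    "(c0 * c1 + c2 * c2) * (d0 * d1 + d2 * d2) = S\<^sup>2 / 4"
    "(c0 * c2 + c1 * c2) * (d0 * d2 + d1 * d2) = s\<^sup>2 / 4"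
    "(c0 * c1 - c2 * c2) * (d0 * d1 - d2 * d2) = (s ^ 4 + S\<^sup>2 * (1 - 2 * s\<^sup>2)) / 4"
    "(c0 * c2 - c1 * c2) * (d0 * d2 - d1 * d2) = s\<^sup>2 * (1 - s\<^sup>2) / 4"
    "(c0 * c1 - c2 * c2) * (d0 * d2 - d1 * d2) + (c0 * c2 - c1 * c2) * (d0 * d1 - d2 * d2) = S * C * s * c / 2"
    "\<i> * ((c0 * c1 - c2 * c2) * (d0 * d2 - d1 * d2) - (c0 * c2 - c1 * c2) * (d0 * d1 - d2 * d2)) =
      - (s * c * (S\<^sup>2 - s\<^sup>2)) / 2"
    "(c1 * c2 * c2) * (d1 * d2 * d2) + (c0 * c2 * c2) * (d0 * d2 * d2) + 2 * ((c0 * c1 * c2) * (d0 * d1 * d2)) =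
      s\<^sup>2 * (s\<^sup>2 + 2 * ((1 - s\<^sup>2) * S\<^sup>2)) / 16"
    "(c1 * c2 * c2) * (d0 * d2 * d2) + (c0 * c2 * c2) * (d1 * d2 * d2) - 2 * ((c0 * c1 * c2) * (d0 * d1 * d2)) =
      - (s\<^sup>2 * (2 * ((1 - s\<^sup>2) * S\<^sup>2)) / 16)"
    "(c1 * c2 * c2) * (d0 * d1 * d2) + (c0 * c1 * c2) * (d1 * d2 * d2)
      - (c0 * c2 * c2) * (d0 * d1 * d2) - (c0 * c1 * c2) * (d0 * d2 * d2) = - (s\<^sup>2 * (2 * (S * C * s * c)) / 16)"
    "c0 * c1 * c2 * c2 * (d0 * d1 * d2 * d2) = s ^ 4 * (s ^ 4 + 4 * ((1 - s\<^sup>2) * S\<^sup>2)) / 256"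
proof -
  have i: "\<i> * \<i> = -1" by simp
  have ww: "w * w' = 1" "w\<^sup>2 + w'\<^sup>2 = 2 * (C\<^sup>2 - S\<^sup>2)" "w\<^sup>2 - w'\<^sup>2 = 4 * \<i> * (S * C)"
    using w C i by Groebner_Basis.algebra+
  have ss: "\<i> * s * (\<i> * s) = - (s * s)" using i by Groebner_Basis.algebra
  have c2: "c2 * c2 = - (s\<^sup>2) / 4" "d2 * d2 = - (s\<^sup>2) / 4" "c2 * d2 = s\<^sup>2 / 4"
    using ss unfolding c2_def d2_def by (simp_all add: power2_eq_square)
  have c01: "c0 * c1 = (w\<^sup>2 - c\<^sup>2) / 4" "d0 * d1 = (w'\<^sup>2 - c\<^sup>2) / 4" "c0 - c1 = c" "d0 - d1 = c"
    "c0 + c1 = w" "d0 + d1 = w'"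
    by (simp_all add: c0_def c1_def d0_def d1_def power2_eq_square field_simps)
  show "c0 * d0 + c1 * d1 + 2 * (c2 * d2) = 1"
    unfolding c0_def c1_def d0_def d1_def c2 using ww(1) c by (simp add: field_simps) Groebner_Basis.algebra
  show "c0 * d1 + c1 * d0 = 2 * (c2 * d2)"
    unfolding c0_def c1_def d0_def d1_def c2 using ww(1) c by (simp add: field_simps) Groebner_Basis.algebra
  show "c0 * d2 + c2 * d0 = c1 * d2 + c2 * d1"
    unfolding c0_def c1_def d0_def d1_def c2_def d2_def by (simp add: field_simps)
  show "(c0 * c1 + c2 * c2) * (d0 * d1 + d2 * d2) = S\<^sup>2 / 4"
    unfolding c01 c2 using ww c C by (simp add: field_simps) Groebner_Basis.algebra
  show "(c0 * c2 + c1 * c2) * (d0 * d2 + d1 * d2) = s\<^sup>2 / 4"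
  proof -
    have "(c0 * c2 + c1 * c2) * (d0 * d2 + d1 * d2) = (c0 + c1) * (d0 + d1) * (c2 * d2)" by (simp add: algebra_simps)
    then show ?thesis unfolding c01 c2 ww by simp
  qed
  show "(c0 * c1 - c2 * c2) * (d0 * d1 - d2 * d2) = (s ^ 4 + S\<^sup>2 * (1 - 2 * s\<^sup>2)) / 4"
    unfolding c01 c2 using ww c C by (simp add: field_simps) Groebner_Basis.algebra
  show "(c0 * c2 - c1 * c2) * (d0 * d2 - d1 * d2) = s\<^sup>2 * (1 - s\<^sup>2) / 4"
  proof -
    have "(c0 * c2 - c1 * c2) * (d0 * d2 - d1 * d2) = (c0 - c1) * (d0 - d1) * (c2 * d2)" by (simp add: algebra_simps)
    also have "\<dots> = c\<^sup>2 * s\<^sup>2 / 4" unfolding c01 c2 by (simp add: power2_eq_square)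
    finally show ?thesis using c by (simp add: field_simps) Groebner_Basis.algebra
  qed
  have v: "c0 * c2 - c1 * c2 = c * (\<i> * s) / 2" "d0 * d2 - d1 * d2 = - (c * (\<i> * s)) / 2"
    using c01(3,4) by (simp_all add: c2_def d2_def flip: left_diff_distrib diff_divide_distrib)
      (simp_all add: field_simps flip: left_diff_distrib)
  show "(c0 * c1 - c2 * c2) * (d0 * d2 - d1 * d2) + (c0 * c2 - c1 * c2) * (d0 * d1 - d2 * d2) = S * C * s * c / 2"
    unfolding c01 c2 v using ww(3) i by (simp add: field_simps)
  show "\<i> * ((c0 * c1 - c2 * c2) * (d0 * d2 - d1 * d2) - (c0 * c2 - c1 * c2) * (d0 * d1 - d2 * d2)) =
      - (s * c * (S\<^sup>2 - s\<^sup>2)) / 2"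
    unfolding c01 c2 v using ww(2) i c C by (simp add: field_simps) Groebner_Basis.algebra
  have n0: "c0 * d0 = (1 + c\<^sup>2 + c * (w + w')) / 4" "c1 * d1 = (1 + c\<^sup>2 - c * (w + w')) / 4"
    using ww(1) by (simp_all add: c0_def c1_def d0_def d1_def field_simps power2_eq_square)
  have x0: "c0 * d1 + c1 * d0 = s\<^sup>2 / 2"
    using ww(1) c unfolding c0_def c1_def d0_def d1_def by (simp add: field_simps) Groebner_Basis.algebra
  have p01: "(c0 * c1) * (d0 * d1) = (s ^ 4 + 4 * ((1 - s\<^sup>2) * S\<^sup>2)) / 16"
    unfolding c01 using ww c C by (simp add: field_simps) Groebner_Basis.algebra
  have "(c1 * c2 * c2) * (d1 * d2 * d2) + (c0 * c2 * c2) * (d0 * d2 * d2) + 2 * ((c0 * c1 * c2) * (d0 * d1 * d2)) =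
     (c1 * d1 + c0 * d0) * ((c2 * d2) * (c2 * d2)) + 2 * ((c0 * c1) * (d0 * d1) * (c2 * d2))"
    by (simp add: algebra_simps)
  also have "\<dots> = s\<^sup>2 * (s\<^sup>2 + 2 * ((1 - s\<^sup>2) * S\<^sup>2)) / 16"
    unfolding n0 p01 c2 using c by (simp add: field_simps) Groebner_Basis.algebra
  finally show "(c1 * c2 * c2) * (d1 * d2 * d2) + (c0 * c2 * c2) * (d0 * d2 * d2) + 2 * ((c0 * c1 * c2) * (d0 * d1 * d2)) =
      s\<^sup>2 * (s\<^sup>2 + 2 * ((1 - s\<^sup>2) * S\<^sup>2)) / 16" .
  have "(c1 * c2 * c2) * (d0 * d2 * d2) + (c0 * c2 * c2) * (d1 * d2 * d2) - 2 * ((c0 * c1 * c2) * (d0 * d1 * d2)) =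
     (c0 * d1 + c1 * d0) * ((c2 * d2) * (c2 * d2)) - 2 * ((c0 * c1) * (d0 * d1) * (c2 * d2))"
    by (simp add: algebra_simps)
  also have "\<dots> = - (s\<^sup>2 * (2 * ((1 - s\<^sup>2) * S\<^sup>2)) / 16)"
    unfolding x0 p01 c2 by (simp add: field_simps)
  finally show "(c1 * c2 * c2) * (d0 * d2 * d2) + (c0 * c2 * c2) * (d1 * d2 * d2) - 2 * ((c0 * c1 * c2) * (d0 * d1 * d2)) =
      - (s\<^sup>2 * (2 * ((1 - s\<^sup>2) * S\<^sup>2)) / 16)" .
  have "(c1 * c2 * c2) * (d0 * d1 * d2) + (c0 * c1 * c2) * (d1 * d2 * d2)
      - (c0 * c2 * c2) * (d0 * d1 * d2) - (c0 * c1 * c2) * (d0 * d2 * d2) =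
     - (c2 * d2) * ((d0 * d1) * (c0 * c2 - c1 * c2) + (c0 * c1) * (d0 * d2 - d1 * d2))"
    by (simp add: algebra_simps)
  also have "\<dots> = - (s\<^sup>2 * (2 * (S * C * s * c)) / 16)"
  proof -
    have "- (c2 * d2) * ((d0 * d1) * (c0 * c2 - c1 * c2) + (c0 * c1) * (d0 * d2 - d1 * d2)) =
        s\<^sup>2 * (c * s) / 32 * (\<i> * (w\<^sup>2 - w'\<^sup>2))"
      unfolding v c01 c2 by (simp add: field_simps)
    then show ?thesis unfolding ww by simp
  qed
  finally show "(c1 * c2 * c2) * (d0 * d1 * d2) + (c0 * c1 * c2) * (d1 * d2 * d2)
      - (c0 * c2 * c2) * (d0 * d1 * d2) - (c0 * c1 * c2) * (d0 * d2 * d2) = - (s\<^sup>2 * (2 * (S * C * s * c)) / 16)" .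
  have "c0 * c1 * c2 * c2 * (d0 * d1 * d2 * d2) = (c0 * c1) * (d0 * d1) * ((c2 * d2) * (c2 * d2))"
    by (simp add: algebra_simps)
  then show "c0 * c1 * c2 * c2 * (d0 * d1 * d2 * d2) = s ^ 4 * (s ^ 4 + 4 * ((1 - s\<^sup>2) * S\<^sup>2)) / 256"
    unfolding p01 c2 by (simp add: power2_eq_square power4_eq_xxxx)
qed

lemma minor_scale:
  fixes G :: "nat \<Rightarrow> nat \<Rightarrow> complex"
  shows "minor2 (\<lambda>j k. c j * d k * G j k) i j k l = c i * c j * (d k * d l) * minor2 G i j k l"
    "minor3 (\<lambda>j k. c j * d k * G j k) i j k p q r = c i * c j * c k * (d p * d q * d r) * minor3 G i j k p q r"
    "minor4 (\<lambda>j k. c j * d k * G j k) = c 0 * c 1 * c 2 * c 3 * (d 0 * d 1 * d 2 * d 3) * minor4 G"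
  unfolding minor4_def minor3_def minor2_def by (simp_all add: algebra_simps)

lemma det_reduced_out_amp_coeffs:
  fixes x y T :: real
  assumes n: "n > 0" and \<phi>: "unit_state m \<phi>" and \<psi>: "unit_state n \<psi>"
  defines "q \<equiv> (sin (2 * y))\<^sup>2" and "t \<equiv> (sin (2 * x))\<^sup>2"
    and "W \<equiv> sin (2 * x) * cos (2 * x) * sin (2 * y) * cos (2 * y)"
    and "a1 \<equiv> bloch1 m \<phi>" and "a2 \<equiv> bloch2 m \<phi>" and "a3 \<equiv> bloch3 m \<phi>"
    and "b1 \<equiv> bloch1 n \<psi>" and "b2 \<equiv> bloch2 n \<psi>" and "b3 \<equiv> bloch3 n \<psi>"
  defines "J \<equiv> sin (2 * y) * cos (2 * y) * (t - q)"
  shows "det (1\<^sub>m (2 * n) + of_real T \<cdot>\<^sub>m reduced_BR m n (out_amp x y y \<phi> \<psi>)) =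
    of_real (1 + T + coeff2 q t W J a1 a2 a3 b1 b2 b3 * T\<^sup>2 + coeff3 q t W a1 a2 a3 b1 b2 b3 * T ^ 3
      + coeff4 q t a1 a2 a3 b1 b2 b3 * T ^ 4)"
proof -
  define C S c s where "C = complex_of_real (cos (2 * x))" and "S = complex_of_real (sin (2 * x))"
    and "c = complex_of_real (cos (2 * y))" and "s = complex_of_real (sin (2 * y))"
  define w w' where "w = C + \<i> * S" and "w' = C - \<i> * S"
  have wC: "Complex (cos (2 * x)) (sin (2 * x)) = w" "cnj w = w'"
    by (simp_all add: w_def w'_def C_def S_def complex_eq_iff)
  have CS: "C\<^sup>2 + S\<^sup>2 = 1" "c\<^sup>2 + s\<^sup>2 = 1"
    unfolding C_def S_def c_def s_def of_real_power[symmetric] of_real_add[symmetric] by simp_all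
  define c0 c1 c2 d0 d1 d2 where "c0 = (w + c) / 2" and "c1 = (w - c) / 2" and "c2 = \<i> * s / 2"
    and "d0 = (w' + c) / 2" and "d1 = (w' - c) / 2" and "d2 = - \<i> * s / 2"
  note prods = coef_products[OF w_def w'_def CS, folded c0_def c1_def c2_def d0_def d1_def d2_def]
  define cv where "cv = (\<lambda>j. [c0, c1, c2, c2] ! j)"
  define dv where "dv = (\<lambda>j. [d0, d1, d2, d2] ! j)"
  have cv: "cv 0 = c0" "cv 1 = c1" "cv 2 = c2" "cv 3 = c2" "dv 0 = d0" "dv 1 = d1" "dv 2 = d2" "dv 3 = d2"
    by (simp_all add: cv_def dv_def numeral_2_eq_2 numeral_3_eq_3)
  define g h where "g = pauli_gram a1 a2 a3" and "h = pauli_gram b1 b2 b3"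
  define N where "N = (\<lambda>j k. cv j * dv k * g j k)"
  define f where "f j l = N j 0 * h l 0 + N j 1 * h l 1 + N j 2 * h l 2 + N j 3 * h l 3" for j l
  have cc: "coef x y y j * cnj (coef x y y k) = cv j * dv k" if "j < 4" "k < 4" for j k
    using coef_mult_cnj[OF that, of x y] unfolding cv_def dv_def c0_def c1_def c2_def d0_def d1_def d2_def
      c_def[symmetric] s_def[symmetric] wC by simp
  have "mat 4 4 (\<lambda>(j, l). \<Sum>k<4. coef x y y j * cnj (coef x y y k) * gram m \<phi> j k * gram n \<psi> l k) =
      mat 4 4 (\<lambda>(j, l). f j l)"
    by (intro eq_matI) (simp_all add: cc gram_eq_pauli_gram[OF \<phi>] gram_eq_pauli_gram[OF \<psi>] lessThan_4_nat
        f_def N_def g_def h_def a1_def a2_def a3_def b1_def b2_def b3_def)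
  then have det: "det (1\<^sub>m (2 * n) + of_real T \<cdot>\<^sub>m reduced_BR m n (out_amp x y y \<phi> \<psi>)) =
      det (1\<^sub>m 4 + of_real T \<cdot>\<^sub>m mat 4 4 (\<lambda>(j, l). f j l))"
    using det_reduced_out_amp[OF n] by simp
  let ?\<alpha> = "1 - (of_real a1)\<^sup>2 - (of_real a2)\<^sup>2 - (of_real a3)\<^sup>2 :: complex"
  let ?\<beta> = "1 - (of_real b1)\<^sup>2 - (of_real b2)\<^sup>2 - (of_real b3)\<^sup>2 :: complex"
  \<comment> \<open>The first three relations in \<open>prods\<close> express the unitarity of
    \<open>U\<close>; they remove all dependence on the Bloch vectors, so the trace stays 1.\<close>
  have tr: "f 0 0 + f 1 1 + f 2 2 + f 3 3 = 1"
  proof -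
    have ii: "\<i> * \<i> = -1" by simp
    have "f 0 0 + f 1 1 + f 2 2 + f 3 3 = (c0 * d0 + c1 * d1 + 2 * (c2 * d2))
       + a1 * b1 * (c0 * d1 + c1 * d0 - 2 * (c2 * d2))
       + (a2 * b2 + a3 * b3) * ((c0 * d2 + c2 * d0) - (c1 * d2 + c2 * d1))"
      unfolding f_def N_def g_def h_def cv pauli_gram_simps of_real_mult of_real_add using ii by Groebner_Basis.algebra
    then show ?thesis by (simp add: prods(1-3))
  qed
  have e2: "minor2 f 0 1 0 1 + minor2 f 0 2 0 2 + minor2 f 0 3 0 3
      + minor2 f 1 2 1 2 + minor2 f 1 3 1 3 + minor2 f 2 3 2 3 = of_real (coeff2 q t W J a1 a2 a3 b1 b2 b3)"
  proof -
    have "minor2 f 0 1 0 1 + minor2 f 0 2 0 2 + minor2 f 0 3 0 3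
      + minor2 f 1 2 1 2 + minor2 f 1 3 1 3 + minor2 f 2 3 2 3 =
     (\<Sum>(p, q) \<leftarrow> [(0, 1), (0, 2), (0, 3), (1, 2), (1, 3), (2, 3)].
     \<Sum>(r, s) \<leftarrow> [(0, 1), (0, 2), (0, 3), (1, 2), (1, 3), (2, 3)].
      [c0, c1, c2, c2] ! p * [c0, c1, c2, c2] ! q * ([d0, d1, d2, d2] ! r * [d0, d1, d2, d2] ! s)
        * minor2 g p q r s * minor2 h p q r s)"
      unfolding minor2_mult_transpose[of f N h, OF f_def] N_def minor_scale
      by (simp add: cv_def dv_def add.assoc)
    also have "4 * \<dots> = 4 * of_real (coeff2 q t W J a1 a2 a3 b1 b2 b3)"
      unfolding g_def h_def pauli_gram_minor2_sum prods coeff2_def Let_def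
        q_def t_def W_def J_def s_def c_def S_def C_def
      by (simp add: field_simps)
    finally show ?thesis by (subst (asm) mult_cancel_left) simp
  qed
  have e3: "minor3 f 1 2 3 1 2 3 + minor3 f 0 2 3 0 2 3 + minor3 f 0 1 3 0 1 3 + minor3 f 0 1 2 0 1 2 =
      of_real (coeff3 q t W a1 a2 a3 b1 b2 b3)"
  proof -
    have ii: "\<i> * \<i> = -1" by simp
    have "minor3 f 1 2 3 1 2 3 + minor3 f 0 2 3 0 2 3 + minor3 f 0 1 3 0 1 3 + minor3 f 0 1 2 0 1 2 =
      ?\<alpha> * ?\<beta> * (((c1 * c2 * c2) * (d1 * d2 * d2) + (c0 * c2 * c2) * (d0 * d2 * d2) + 2 * ((c0 * c1 * c2) * (d0 * d1 * d2)))
       + a1 * b1 * ((c1 * c2 * c2) * (d0 * d2 * d2) + (c0 * c2 * c2) * (d1 * d2 * d2) - 2 * ((c0 * c1 * c2) * (d0 * d1 * d2)))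
       + (a2 * b2 + a3 * b3) * ((c1 * c2 * c2) * (d0 * d1 * d2) + (c0 * c1 * c2) * (d1 * d2 * d2)
      - (c0 * c2 * c2) * (d0 * d1 * d2) - (c0 * c1 * c2) * (d0 * d2 * d2)))"
      unfolding minor3_mult_transpose[of f N h, OF f_def] N_def minor_scale cv g_def h_def minor3_pauli_gram of_real_mult of_real_add
      using ii by Groebner_Basis.algebra
    also have "\<dots> = of_real (coeff3 q t W a1 a2 a3 b1 b2 b3)"
    proof -
      have h: "s\<^sup>2 * (s\<^sup>2 + 2 * ((1 - s\<^sup>2) * S\<^sup>2)) / 16 + u * - (s\<^sup>2 * (2 * ((1 - s\<^sup>2) * S\<^sup>2)) / 16)
          + v * - (s\<^sup>2 * (2 * (S * C * s * c)) / 16) =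
        s\<^sup>2 * (s\<^sup>2 + 2 * ((1 - s\<^sup>2) * S\<^sup>2) - 2 * ((1 - s\<^sup>2) * S\<^sup>2) * u - 2 * (S * C * s * c) * v) / 16" for u v
        by (simp add: field_simps)
      show ?thesis
        unfolding prods h unfolding coeff3_def q_def t_def W_def s_def c_def S_def C_def by simp
    qed
    finally show ?thesis .
  qed
  have e4: "minor4 f = of_real (coeff4 q t a1 a2 a3 b1 b2 b3)"
    unfolding minor4_mult_transpose[of f N h, OF f_def] N_def minor_scale cv g_def h_def minor4_pauli_gram prods
      coeff4_def q_def t_def s_def S_def by (simp add: power_mult_distrib flip: power_mult)
  show ?thesis
    unfolding det det_one_plus_smult_mat4 tr e2 e3 e4 by simp
qed

section \<open>Polynomial inequalities\<close>

lemma quadratic_form_nonneg: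
  fixes A B N x :: real
  assumes "A > 0" "B\<^sup>2 \<le> A * N"
  shows "A * x\<^sup>2 + 2 * B * x + N \<ge> 0"
proof -
  have "A * (A * x\<^sup>2 + 2 * B * x + N) = (A * x + B)\<^sup>2 + (A * N - B\<^sup>2)"
    by (simp add: power2_eq_square algebra_simps)
  also have "\<dots> \<ge> 0" using assms by simp
  finally show ?thesis using assms(1) by (simp add: zero_le_mult_iff)
qed

text \<open>The certificates below are nonnegative expansions in the barycentric coordinates of the triangle
  \<open>0 \<le> r \<le> l \<le> 1\<close>.\<close>

lemma acute_poly_nonneg:
  fixes r l v :: real
  assumes "0 \<le> r" "r \<le> l" "l \<le> 1" "0 \<le> v" "v \<le> 1"
  defines "z \<equiv> r + l\<^sup>2"
  defines "R0 \<equiv> 2 * (1 - r) * (1 + l) + (2 + r) * z"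
    and "R2 \<equiv> r * z - 2 * l * (1 + l) * (1 + r)"
    and "R3 \<equiv> (1 + l) * (r * z - 2 * (1 + l\<^sup>2) * (1 + r)) / 2"
  shows "R2 \<le> 0"
    "8 * v * r * (1 + l)\<^sup>2 * (1 - l) \<le>
      ((1 - v) * ((2 + r) * z) + v * (2 * z + 2 * r * (1 + r))) * (R0 + v * R2 + (1 - v) * R3)"
proof -
  define x y where "x = l - r" and "y = 1 - l"
  have pos: "0 \<le> r" "0 \<le> x" "0 \<le> y" using assms by (auto simp: x_def y_def)
  have "- R2 = 6 * r ^ 3 + 17 * r ^ 2 * x + 7 * r ^ 2 * y + 15 * r * x ^ 2 + 14 * r * x * y
      + 2 * r * y ^ 2 + 4 * x ^ 3 + 6 * x ^ 2 * y + 2 * x * y ^ 2"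
    unfolding R2_def z_def x_def y_def by Groebner_Basis.algebra
  also have "\<dots> \<ge> 0" using pos by simp
  finally show "R2 \<le> 0" by simp
  have U: "R0 + R3 = 3 * r ^ 3 * y + 2 * r ^ 2 * x ^ 2 + 21 / 2 * r ^ 2 * x * y + 11 / 2 * r ^ 2 * y ^ 2
      + 4 * r * x ^ 3 + 31 / 2 * r * x ^ 2 * y + 14 * r * x * y ^ 2 + 4 * r * y ^ 3 + 2 * x ^ 4
      + 8 * x ^ 3 * y + 10 * x ^ 2 * y ^ 2 + 5 * x * y ^ 3 + y ^ 4"
    unfolding R0_def R3_def z_def x_def y_def by (simp add: field_simps) Groebner_Basis.algebra
  have "R0 + R3 \<ge> 0" unfolding U using pos by simp
  then have b0: "(2 + r) * z * (R0 + R3) \<ge> 0" using pos by (simp add: z_def)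
  have "(2 + r) * z * (R0 + R2) + (2 * z + 2 * r * (1 + r)) * (R0 + R3) - 8 * r * (1 + l)\<^sup>2 * (1 - l) =
      16 * r ^ 5 * y + 28 * r ^ 4 * x ^ 2 + 80 * r ^ 4 * x * y + 24 * r ^ 4 * y ^ 2 + 86 * r ^ 3 * x ^ 3
      + 220 * r ^ 3 * x ^ 2 * y + 112 * r ^ 3 * x * y ^ 2 + 12 * r ^ 3 * y ^ 3 + 96 * r ^ 2 * x ^ 4
      + 285 * r ^ 2 * x ^ 3 * y + 227 * r ^ 2 * x ^ 2 * y ^ 2 + 52 * r ^ 2 * x * y ^ 3 + 2 * r ^ 2 * y ^ 4
      + 46 * r * x ^ 5 + 161 * r * x ^ 4 * y + 178 * r * x ^ 3 * y ^ 2 + 74 * r * x ^ 2 * y ^ 3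
      + 8 * r * x * y ^ 4 + 8 * x ^ 6 + 32 * x ^ 5 * y + 44 * x ^ 4 * y ^ 2 + 26 * x ^ 3 * y ^ 3
      + 6 * x ^ 2 * y ^ 4"
    unfolding R0_def R2_def R3_def z_def x_def y_def by (simp add: field_simps) Groebner_Basis.algebra
  also have "\<dots> \<ge> 0" using pos by simp
  finally have b1: "(2 + r) * z * (R0 + R2) + (2 * z + 2 * r * (1 + r)) * (R0 + R3)
      - 8 * r * (1 + l)\<^sup>2 * (1 - l) \<ge> 0" .
  have b2: "(2 * z + 2 * r * (1 + r)) * (R0 + R2) - 8 * r * (1 + l)\<^sup>2 * (1 - l) = 4 * (1 + r)\<^sup>2 * (l - r)\<^sup>2"
    unfolding R0_def R2_def z_def by Groebner_Basis.algebra
  \<comment> \<open>Degree-two Bernstein form in v. The facts \<open>b0\<close>, \<open>b1\<close>,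
    \<open>b2\<close> control its coefficients; the last is a square that vanishes at l = r, so the
    bound is tight there.\<close>
  have "((1 - v) * ((2 + r) * z) + v * (2 * z + 2 * r * (1 + r))) * (R0 + v * R2 + (1 - v) * R3)
      - 8 * v * r * (1 + l)\<^sup>2 * (1 - l) =
    (1 - v)\<^sup>2 * ((2 + r) * z * (R0 + R3))
    + v * (1 - v) * ((2 + r) * z * (R0 + R2) + (2 * z + 2 * r * (1 + r)) * (R0 + R3) - 8 * r * (1 + l)\<^sup>2 * (1 - l))
    + v\<^sup>2 * ((2 * z + 2 * r * (1 + r)) * (R0 + R2) - 8 * r * (1 + l)\<^sup>2 * (1 - l))"
    by Groebner_Basis.algebra
  also have "\<dots> \<ge> 0"
    unfolding b2 using assms(4,5)
    by (intro add_nonneg_nonneg mult_nonneg_nonneg[OF _ b0] mult_nonneg_nonneg[OF _ b1]) auto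
  finally show "8 * v * r * (1 + l)\<^sup>2 * (1 - l) \<le>
      ((1 - v) * ((2 + r) * z) + v * (2 * z + 2 * r * (1 + r))) * (R0 + v * R2 + (1 - v) * R3)"
    by simp
qed

text \<open>Here the triangle has vertices \<open>(0, 0)\<close>, \<open>(1, 0)\<close> and \<open>(1/2, 1/2)\<close> in the \<open>(q, k)\<close> plane, and the
  expansion in \<open>v\<close> is in the Bernstein basis.\<close>

lemma obtuse_poly_nonneg:
  fixes q k v d :: real
  assumes "0 \<le> k" "k \<le> q" "q + k \<le> 1" "0 \<le> d" "d \<le> v" "v \<le> 1"
  defines "m \<equiv> (1 - q) * (1 - k)" and "W \<equiv> (q * (1 - q) + k * (1 - k)) / 2"
  defines "Y \<equiv> \<lambda>d. 2 * (1 - v) * (2 * m + q\<^sup>2 - 2 * q * (1 - q) + d * (q\<^sup>2 - 2 * W) + (1 - v) * (q\<^sup>2 / 2 - m))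
      + d * (2 * q * (2 - q) - 4 * W - 2 * q * k)"
  shows "16 * (1 - v) * v * (1 - q) * (1 - k - q)\<^sup>2 \<le> ((1 - v) * (2 - q) + v * (4 - 2 * q - 2 * k)) * Y d"
proof -
  define x y where "x = 1 - q - k" and "y = q - k"
  have pos: "0 \<le> k" "0 \<le> x" "0 \<le> y" using assms by (auto simp: x_def y_def)
  have v: "0 \<le> v" "0 \<le> 1 - v" using assms by auto
  \<comment> \<open>This is affine in d, so only the endpoints d = 0 and d = v need a
    certificate.\<close>
  define f where "f d = ((1 - v) * (2 - q) + v * (4 - 2 * q - 2 * k)) * Y d
     - 16 * (1 - v) * v * (1 - q) * (1 - k - q)\<^sup>2" for d
  have "f 0 = (1 - v) ^ 3 * (4 * x ^ 4 + 2 * x ^ 3 * y + 14 * x ^ 3 * k + 2 * x ^ 2 * y ^ 2 + 4 * x ^ 2 * y * k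
        + 14 * x ^ 2 * k ^ 2 + 7 * x * y ^ 3 + 23 * x * y ^ 2 * k + 19 * x * y * k ^ 2 + 7 * x * k ^ 3 + 3 * y ^ 4
        + 19 * y ^ 3 * k + 39 * y ^ 2 * k ^ 2 + 29 * y * k ^ 3 + 6 * k ^ 4)
    + (1 - v)\<^sup>2 * v * (12 * x ^ 2 * k + 12 * x * y ^ 2 + 20 * x * y * k + 20 * x * k ^ 2 + 8 * y ^ 3
        + 30 * y ^ 2 * k + 32 * y * k ^ 2 + 10 * k ^ 3)
    + (1 - v) * v\<^sup>2 * (8 * x ^ 2 * y + 16 * x ^ 2 * k + 8 * x * y ^ 2 + 24 * x * y * k + 24 * x * k ^ 2 + 4 * y ^ 3
        + 16 * y ^ 2 * k + 20 * y * k ^ 2 + 8 * k ^ 3)"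
    unfolding f_def Y_def W_def m_def x_def y_def by (simp add: field_simps) Groebner_Basis.algebra
  also have "\<dots> \<ge> 0" using pos v by simp
  finally have f0: "f 0 \<ge> 0" .
  have "f v = (1 - v) ^ 3 * (4 * x ^ 4 + 2 * x ^ 3 * y + 14 * x ^ 3 * k + 2 * x ^ 2 * y ^ 2 + 4 * x ^ 2 * y * k
        + 14 * x ^ 2 * k ^ 2 + 7 * x * y ^ 3 + 23 * x * y ^ 2 * k + 19 * x * y * k ^ 2 + 7 * x * k ^ 3 + 3 * y ^ 4
        + 19 * y ^ 3 * k + 39 * y ^ 2 * k ^ 2 + 29 * y * k ^ 3 + 6 * k ^ 4)
    + (1 - v)\<^sup>2 * v * (4 * x ^ 2 * k + 20 * x * y ^ 2 + 20 * x * y * k + 4 * x * k ^ 2 + 12 * y ^ 3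
        + 44 * y ^ 2 * k + 36 * y * k ^ 2 + 4 * k ^ 3)
    + (1 - v) * v\<^sup>2 * (12 * x ^ 2 * y + 30 * x * y ^ 2 + 34 * x * y * k + 14 * y ^ 3 + 44 * y ^ 2 * k + 30 * y * k ^ 2)
    + v ^ 3 * (8 * x ^ 2 * y + 12 * x * y ^ 2 + 16 * x * y * k + 4 * y ^ 3 + 12 * y ^ 2 * k + 8 * y * k ^ 2)"
    unfolding f_def Y_def W_def m_def x_def y_def by (simp add: field_simps) Groebner_Basis.algebra
  also have "\<dots> \<ge> 0" using pos v by simp
  finally have fv: "f v \<ge> 0" .
  have "f d \<ge> 0"
  proof (cases "v = 0")
    case True
    then show ?thesis using f0 assms by simp
  next
    case False
    have "v * f d = (v - d) * f 0 + d * f v"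
      unfolding f_def Y_def by (simp add: field_simps)
    also have "\<dots> \<ge> 0" using f0 fv assms by simp
    finally show ?thesis using False v by (simp add: zero_le_mult_iff)
  qed
  then show ?thesis by (simp add: f_def)
qed

section \<open>Domination by axis states\<close>

text \<open>In terms of the Bloch vectors: \<open>w = - a1 b1\<close>, \<open>\<eta> = a1 - b1\<close>, \<open>P = a1\<^sup>2 + b1\<^sup>2\<close>; \<open>d\<close> and \<open>\<tau>\<close> are minus the
  inner product and the cross product of the components orthogonal to the first axis, \<open>H\<close> is the sum of the
  squares of their lengths and \<open>g\<close> the product of these lengths.\<close>

locale gap_setup =
  fixes q t W J P H K w d \<tau> \<eta> g :: real
  assumes q: "0 < q" "q < 1" and t: "q \<le> t" "t \<le> 1"
    and W: "0 \<le> W" "W\<^sup>2 = (1 - q) * q * t * (1 - t)" and J: "J\<^sup>2 = q * (1 - q) * (t - q)\<^sup>2"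
    and P: "2 * \<bar>w\<bar> \<le> P" and \<eta>: "\<eta>\<^sup>2 = P + 2 * w" and g: "0 \<le> g" "g\<^sup>2 = d\<^sup>2 + \<tau>\<^sup>2"
    and H: "2 * g \<le> H" and K: "2 * \<bar>w\<bar> * g \<le> K" and PH: "P + H \<le> 2"
begin

abbreviation m :: real where "m \<equiv> (1 - q) * t"

text \<open>\<open>gap s / 8\<close> is the amount by which \<open>coeff2\<close> at the axis state of parameter \<open>s\<close> exceeds its value at the
  given Bloch vectors.\<close>

definition gap :: "real \<Rightarrow> real" where
  "gap s = s * (4 * W - 2 * q * (2 - q)) + s\<^sup>2 * q * (2 - q - 2 * t) - 4 * q * (1 - q) * w
    - 4 * W * d * (1 + w) - (2 * m - q\<^sup>2) * w\<^sup>2 - 2 * q * (1 - q) * d\<^sup>2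
    + (2 * q * t - q\<^sup>2) * (d\<^sup>2 + \<tau>\<^sup>2) + (2 * m + q\<^sup>2) * P + q * (2 - q) * H + q\<^sup>2 * K + 4 * J * \<eta> * \<tau>"

lemma basic:
  shows t_pos: "0 < t" and m_pos: "0 < m" and g_le: "g \<le> 1 - \<bar>w\<bar>" and d_le: "\<bar>d\<bar> \<le> g" and w_le: "\<bar>w\<bar> \<le> 1"
    and K_nonneg: "0 \<le> K"
proof -
  show "0 < t" using q t by simp
  then show "0 < m" using q by simp
  show "g \<le> 1 - \<bar>w\<bar>" using P H PH by simp
  have "\<bar>d\<bar>\<^sup>2 \<le> g\<^sup>2" using g(2) by simp
  then show "\<bar>d\<bar> \<le> g" using g(1) by (rule power2_le_imp_le)
  show "\<bar>w\<bar> \<le> 1" using P H PH g by simp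
  show "0 \<le> K" by (rule order.trans[OF _ K]) (use g in simp)
qed

text \<open>The discriminant condition for q (2 - 2q + 2t) \<open>\<tau>\<close>^2 + 4 J
  \<open>\<eta>\<close> \<open>\<tau>\<close> + (2m + q^2) \<open>\<eta>\<close>^2 as a form in
  \<open>\<tau>\<close> and \<open>\<eta>\<close>.\<close>

lemma tau_bound: "J\<^sup>2 * 4 \<le> q * (2 - 2 * q + 2 * t) * (2 * m + q\<^sup>2)"
proof -
  have "(t - q)\<^sup>2 \<le> t\<^sup>2" using q t by (intro power_mono) auto
  then have "4 * (1 - q) * (t - q)\<^sup>2 \<le> 4 * (1 - q) * t\<^sup>2" using q by simp
  also have "\<dots> = 2 * t * (2 * m)" by (simp add: power2_eq_square)
  also have "\<dots> \<le> (2 - 2 * q + 2 * t) * (2 * m + q\<^sup>2)"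
    using q t_pos m_pos by (intro mult_mono) auto
  finally have "q * (4 * (1 - q) * (t - q)\<^sup>2) \<le> q * ((2 - 2 * q + 2 * t) * (2 * m + q\<^sup>2))"
    using q by (intro mult_left_mono) auto
  moreover have "J\<^sup>2 * 4 = q * (4 * (1 - q) * (t - q)\<^sup>2)" unfolding J by simp
  ultimately show ?thesis by (simp only: mult.assoc)
qed

text \<open>A quadratic form in \<open>\<tau>\<close>: the term linear in \<open>\<tau>\<close>, which is present only when the Bloch vectors are not
  collinear, is absorbed by \<open>Hd\<close> (of order \<open>\<tau>\<^sup>2\<close>) and \<open>core\<close>.\<close>

lemma nonneg_of_core:
  assumes w: "0 \<le> w" and Hd: "\<tau>\<^sup>2 \<le> (1 - w) * Hd" "0 \<le> Hd"
    and core: "16 * w * (1 - w) * (1 - q) * (t - q)\<^sup>2 \<le> (w * (2 - q) + (1 - w) * (2 - 2 * q + 2 * t)) * core"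
    and X: "q * (2 - q) * Hd + q * (2 * t - q) * \<tau>\<^sup>2 + 4 * J * \<eta> * \<tau> + (P - 2 * w) * (2 * m + q\<^sup>2) + core \<le> X"
  shows "0 \<le> X"
proof -
  define v where "v = 1 - w"
  have v: "0 \<le> v" "v \<le> 1" "w = 1 - v" using w w_le by (auto simp: v_def)
  define B where "B = (1 - v) * (2 - q) + v * (2 - 2 * q + 2 * t)"
  have tq: "0 < t" using t_pos .
  have B1: "2 - q \<le> 2 - 2 * q + 2 * t" using q t by simp
  have "B = (2 - q) + v * (2 * t - q)" by (simp add: B_def algebra_simps)
  moreover have "v * (2 * t - q) \<ge> 0" using v q t by simp
  ultimately have B: "0 < B" using q by simp
  have vB: "v * (2 - 2 * q + 2 * t) \<le> B" using v q by (simp add: B_def)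
  define Z where "Z = P - 2 * w"
  have Z: "0 \<le> Z" "\<eta>\<^sup>2 = Z + 4 * w" using P w \<eta> by (auto simp: Z_def)
  define N where "N = Z * (2 * m + q\<^sup>2) + core"
  have mq: "0 \<le> 2 * m + q\<^sup>2" using m_pos by simp
  have core': "16 * w * v * (1 - q) * (t - q)\<^sup>2 \<le> B * core" using core v by (simp add: B_def)
  \<comment> \<open>Split \<open>\<eta>\<close>^2 = Z + 4w: \<open>tau_bound\<close> pays for the
    part with Z, the hypothesis \<open>core\<close> for the part with 4w.\<close>
  have BN: "4 * v * J\<^sup>2 * \<eta>\<^sup>2 \<le> q * B * N"
  proof -
    have "v * (J\<^sup>2 * 4) \<le> v * (q * (2 - 2 * q + 2 * t) * (2 * m + q\<^sup>2))"
      using tau_bound v by (intro mult_left_mono)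
    also have "\<dots> = q * (v * (2 - 2 * q + 2 * t)) * (2 * m + q\<^sup>2)" by simp
    also have "\<dots> \<le> q * B * (2 * m + q\<^sup>2)" using vB q mq by (intro mult_right_mono mult_left_mono) auto
    finally have "Z * (v * (J\<^sup>2 * 4)) \<le> Z * (q * B * (2 * m + q\<^sup>2))" using Z by (intro mult_left_mono)
    moreover have "q * (16 * w * v * (1 - q) * (t - q)\<^sup>2) \<le> q * (B * core)"
      using core' q by (intro mult_left_mono) auto
    moreover have "q * (16 * w * v * (1 - q) * (t - q)\<^sup>2) = 4 * v * J\<^sup>2 * (4 * w)" unfolding J by simp
    ultimately show ?thesis unfolding N_def Z(2) by (simp add: algebra_simps)
  qed
  have "0 \<le> q * B * N" by (rule order.trans[OF _ BN]) (use v in simp)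
  moreover have "0 < q * B" using B q by simp
  ultimately have N: "0 \<le> N" by (simp only: zero_le_mult_iff) linarith
  show ?thesis
  proof (cases "v = 0")
    case True
    then have "\<tau>\<^sup>2 \<le> 0" using Hd v by simp
    then have "\<tau> = 0" by simp
    moreover have "0 \<le> q * (2 - q) * Hd" using q Hd by simp
    ultimately show ?thesis using X N by (simp add: N_def Z_def)
  next
    case False
    then have v0: "0 < v" using v by simp
    have qB: "0 < q * B" using q B by simp
    \<comment> \<open>Everything is multiplied by v, because only v Hd dominates
      \<open>\<tau>\<close>^2. Up to the factor v in the constant term, \<open>BN\<close> is the
      discriminant condition.\<close>
    have "0 \<le> q * B * \<tau>\<^sup>2 + 2 * (2 * v * J * \<eta>) * \<tau> + v * N"
    proof (rule quadratic_form_nonneg[OF qB])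
      have "(2 * v * J * \<eta>)\<^sup>2 = v * (4 * v * J\<^sup>2 * \<eta>\<^sup>2)" by (simp add: power_mult_distrib power2_eq_square)
      also have "\<dots> \<le> v * (q * B * N)" using BN v by (intro mult_left_mono)
      finally show "(2 * v * J * \<eta>)\<^sup>2 \<le> q * B * (v * N)" by (simp add: mult_ac)
    qed
    also have "q * B * \<tau>\<^sup>2 = q * (2 - q) * \<tau>\<^sup>2 + v * (q * (2 * t - q) * \<tau>\<^sup>2)"
      by (simp add: B_def algebra_simps)
    also have "q * (2 - q) * \<tau>\<^sup>2 \<le> q * (2 - q) * (v * Hd)"
      using Hd v q by (intro mult_left_mono) auto
    finally have "0 \<le> v * (q * (2 - q) * Hd + q * (2 * t - q) * \<tau>\<^sup>2 + 4 * J * \<eta> * \<tau> + N)"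
      by (simp add: algebra_simps)
    then have "0 \<le> q * (2 - q) * Hd + q * (2 * t - q) * \<tau>\<^sup>2 + 4 * J * \<eta> * \<tau> + N"
      using v0 by (simp add: zero_le_mult_iff)
    then show ?thesis using X by (simp add: N_def Z_def)
  qed
qed

text \<open>H - 2d is what remains of H after the core has received 2d. The bound combines
  \<open>\<tau>\<close>^2 = (g - d)(g + d) with g <= 1 - w and 2g <= H.\<close>

lemma Hd_pos: assumes "0 \<le> w" "0 \<le> d" shows "\<tau>\<^sup>2 \<le> (1 - w) * (H - 2 * d)" "0 \<le> H - 2 * d"
proof -
  show Hd: "0 \<le> H - 2 * d" using H d_le by simp
  have "\<tau>\<^sup>2 = (g - d) * (g + d)" using g(2) by (simp add: power2_eq_square algebra_simps)
  also have "\<dots> \<le> (g - d) * (2 * (1 - w))"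
    using d_le g_le assms by (intro mult_left_mono) auto
  also have "\<dots> \<le> (1 - w) * (H - 2 * d)"
    using H g_le g assms mult_left_mono[of "2 * (g - d)" "H - 2 * d" "1 - w"] by (simp add: algebra_simps)
  finally show "\<tau>\<^sup>2 \<le> (1 - w) * (H - 2 * d)" .
qed

text \<open>The witness is g. Since 2g <= H, one half of H provides g and the other absorbs the
  negative term in d^2, because d^2 <= g^2 <= g.\<close>

lemma Hd_neg:
  assumes "0 \<le> w" "d \<le> 0"
  obtains Hd where "\<tau>\<^sup>2 \<le> (1 - w) * Hd" "0 \<le> Hd" "q * (2 - q) * Hd \<le> q * (2 - q) * H - 2 * q * (1 - q) * d\<^sup>2"
proof
  have gv: "g * g \<le> (1 - w) * g" using g_le assms g by (intro mult_right_mono) auto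
  have dg: "d\<^sup>2 \<le> g\<^sup>2" using g by simp
  have "g \<le> 1" using g_le assms by simp
  then have "g\<^sup>2 \<le> g" using mult_left_le[of g g] g(1) by (simp add: power2_eq_square)
  then have dg1: "d\<^sup>2 \<le> g" using dg by simp
  show "\<tau>\<^sup>2 \<le> (1 - w) * g" 
  proof -
    have "\<tau>\<^sup>2 \<le> g * g" using g(2) by (simp flip: power2_eq_square)
    then show ?thesis using gv by linarith
  qed
  show "0 \<le> g" using g(1) .
  have "q * (2 - q) * g + 2 * q * (1 - q) * d\<^sup>2 \<le> q * (2 - q) * g + q * (2 - q) * g"
  proof -
    have "2 * q * (1 - q) \<le> q * (2 - q)" by (simp add: algebra_simps)
    then have "2 * q * (1 - q) * d\<^sup>2 \<le> q * (2 - q) * g"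
      by (rule mult_mono[OF _ dg1]) (use q in auto)
    then show ?thesis by linarith
  qed
  also have "\<dots> \<le> q * (2 - q) * H" using H q mult_left_mono[of "2 * g" H "q * (2 - q)"] by (simp add: algebra_simps)
  finally show "q * (2 - q) * g \<le> q * (2 - q) * H - 2 * q * (1 - q) * d\<^sup>2" by simp
qed

lemma Kd: assumes "0 \<le> w" "0 \<le> d" shows "2 * w * d \<le> K"
  using K d_le assms mult_left_mono[of d g "2 * w"] by simp

section \<open>The gap when a1 b1 is nonnegative\<close>

lemma gap_nonneg_w_neg:
  assumes w: "w \<le> 0" and Hd: "\<tau>\<^sup>2 \<le> Hd"
    and X: "q * (2 - q) * Hd + q * (2 * t - q) * \<tau>\<^sup>2 + 4 * J * \<eta> * \<tau> + (2 * m + q\<^sup>2) * P - (2 * m - q\<^sup>2) * w\<^sup>2 \<le> X"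
  shows "0 \<le> X"
proof -
  \<comment> \<open>Writing P = \<open>\<eta>\<close>^2 - 2w and using w^2 <= -w, the terms in P and
    w^2 dominate (2m + q^2) \<open>\<eta>\<close>^2, and \<open>tau_bound\<close> applies
    directly.\<close>
  have "w\<^sup>2 \<le> - w" 
    using mult_left_le[of "- w" "- w"] w w_le by (simp add: power2_eq_square)
  then have "(2 * m + q\<^sup>2) * w\<^sup>2 \<le> (2 * m + q\<^sup>2) * (- 2 * w)"
    using m_pos w by (intro mult_left_mono) auto
  moreover have "(2 * m - q\<^sup>2) * w\<^sup>2 \<le> (2 * m + q\<^sup>2) * w\<^sup>2" by (intro mult_right_mono) auto
  moreover have "(2 * m + q\<^sup>2) * P = (2 * m + q\<^sup>2) * \<eta>\<^sup>2 + (2 * m + q\<^sup>2) * (- 2 * w)"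
    unfolding \<eta> by (simp add: algebra_simps)
  ultimately have 1: "(2 * m + q\<^sup>2) * \<eta>\<^sup>2 \<le> (2 * m + q\<^sup>2) * P - (2 * m - q\<^sup>2) * w\<^sup>2" by simp
  have 2: "q * (2 - q) * \<tau>\<^sup>2 \<le> q * (2 - q) * Hd" using Hd q by (intro mult_left_mono) auto
  have pos: "0 < q * (2 - 2 * q + 2 * t)" using q t_pos by simp
  have "0 \<le> q * (2 - 2 * q + 2 * t) * \<tau>\<^sup>2 + 2 * (2 * J * \<eta>) * \<tau> + (2 * m + q\<^sup>2) * \<eta>\<^sup>2"
  proof (rule quadratic_form_nonneg[OF pos])
    have "(2 * J * \<eta>)\<^sup>2 = (J\<^sup>2 * 4) * \<eta>\<^sup>2" by (simp add: power_mult_distrib)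
    also have "\<dots> \<le> q * (2 - 2 * q + 2 * t) * (2 * m + q\<^sup>2) * \<eta>\<^sup>2"
      using tau_bound by (intro mult_right_mono) auto
    finally show "(2 * J * \<eta>)\<^sup>2 \<le> q * (2 - 2 * q + 2 * t) * ((2 * m + q\<^sup>2) * \<eta>\<^sup>2)" by (simp add: mult_ac)
  qed
  then show ?thesis using X 1 2 by (simp add: algebra_simps)
qed

text \<open>The first axis contributes nothing to the witness here. The estimate holds on both sides
  of q + t = 1, so it serves the acute and the obtuse case.\<close>

lemma gap_w_neg:
  assumes w: "w \<le> 0"
  shows "0 \<le> gap (max d 0)"
proof (cases "0 \<le> d")
  case d: True
  have "\<tau>\<^sup>2 = (g - d) * (g + d)" using g(2) by (simp add: power2_eq_square algebra_simps)
  also have "\<dots> \<le> (g - d) * 2" using d_le g_le by (intro mult_left_mono) auto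
  also have "\<dots> \<le> H - 2 * d" using H by simp
  finally have Hd: "\<tau>\<^sup>2 \<le> H - 2 * d" .
  show ?thesis
  proof (rule gap_nonneg_w_neg[OF w Hd])
    have "0 \<le> q\<^sup>2 * K" using K_nonneg by simp
    moreover have "0 \<le> - (4 * q * (1 - q) * w)" "0 \<le> - (4 * W * d * w)"
      using q w W d by (simp_all add: mult_nonneg_nonpos)
    ultimately show "q * (2 - q) * (H - 2 * d) + q * (2 * t - q) * \<tau>\<^sup>2 + 4 * J * \<eta> * \<tau> + (2 * m + q\<^sup>2) * P
        - (2 * m - q\<^sup>2) * w\<^sup>2 \<le> gap (max d 0)"
      using d by (simp add: gap_def max_def algebra_simps power2_eq_square)
  qed
next
  case False
  then have d: "d \<le> 0" by simp
  have w0: "0 \<le> 1 + w" using w_le by simp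
  have "g \<le> 1" using g_le by simp
  then have gg: "g\<^sup>2 \<le> g" using mult_left_le[of g g] g(1) by (simp add: power2_eq_square)
  then have Hd: "\<tau>\<^sup>2 \<le> H - d\<^sup>2" using g(2) H g(1) by simp
  show ?thesis
  proof (rule gap_nonneg_w_neg[OF w Hd])
    have "0 \<le> q\<^sup>2 * K" using K_nonneg by simp
    moreover have "0 \<le> - (4 * q * (1 - q) * w)" using q w by (simp add: mult_nonneg_nonpos)
    moreover have "0 \<le> - (4 * W * d * (1 + w))" using w0 W d by (simp add: mult_nonneg_nonpos mult_nonpos_nonneg)
    moreover have "0 \<le> 2 * q * t * d\<^sup>2" using q t by simp
    ultimately show "q * (2 - q) * (H - d\<^sup>2) + q * (2 * t - q) * \<tau>\<^sup>2 + 4 * J * \<eta> * \<tau> + (2 * m + q\<^sup>2) * P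
        - (2 * m - q\<^sup>2) * w\<^sup>2 \<le> gap (max d 0)"
      using False by (simp add: gap_def max_def algebra_simps power2_eq_square)
  qed
qed

text \<open>This is \<open>tan 2y / tan 2x\<close>. The condition \<open>q + t \<le> 1\<close> below means \<open>2x + 2y \<le> \<pi>/2\<close>.\<close>

definition ell :: real where "ell = W / m"

lemma ell: "0 \<le> ell" "ell \<le> 1" "W = ell * m" "ell\<^sup>2 * m = q * (1 - t)"
proof -
  show "0 \<le> ell" using W m_pos by (simp add: ell_def)
  have "W = W / M * M" if "0 < M" for M using that by simp
  from this[OF m_pos] show Wl: "W = ell * m" unfolding ell_def .
  have "(ell\<^sup>2 * m) * m = (ell * m)\<^sup>2" by (simp add: power2_eq_square)
  also have "\<dots> = (q * (1 - t)) * m" using W(2) unfolding Wl[symmetric] by simp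
  finally have "(ell\<^sup>2 * m) * m = (q * (1 - t)) * m" .
  then show sq: "ell\<^sup>2 * m = q * (1 - t)" using q t_pos by simp
  have "q * (1 - t) \<le> 1 * m" using t by (simp add: algebra_simps)
  then have "ell\<^sup>2 * m \<le> 1 * m" unfolding sq .
  then have "ell\<^sup>2 \<le> 1" using m_pos by (rule mult_right_le_imp_le)
  then show "ell \<le> 1" using power2_le_imp_le[of ell 1] by simp
qed

text \<open>\<open>core\<close> is \<open>gap s\<close> at d = e, \<open>\<tau>\<close> = 0 with P,
  H, K replaced by their lower bounds 2w, 2e, 2we. It is applied with e = d or, for negative d, with
  e = 0.\<close>

lemma acute_core:
  assumes "q + t \<le> 1" "0 \<le> w" "0 \<le> e" "e \<le> 1 - w"
  defines "s \<equiv> e + ell * w"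
  defines "core \<equiv> s * (4 * W - 2 * q * (2 - q)) + s\<^sup>2 * q * (2 - q - 2 * t) - 4 * q * (1 - q) * w
    - 4 * W * e * (1 + w) - (2 * m - q\<^sup>2) * w\<^sup>2 - 2 * q * (1 - q) * e\<^sup>2 + (2 * q * t - q\<^sup>2) * e\<^sup>2
    + (2 * m + q\<^sup>2) * (2 * w) + q * (2 - q) * (2 * e) + q\<^sup>2 * (2 * w * e)"
  shows "16 * w * (1 - w) * (1 - q) * (t - q)\<^sup>2 \<le> (w * (2 - q) + (1 - w) * (2 - 2 * q + 2 * t)) * core"
proof -
  define l where "l = ell"
  define M where "M = m"
  define v where "v = 1 - w"
  \<comment> \<open>r = tan^2 2y and l = tan 2y / tan 2x make everything rational, W included: t = r
    / z. The condition q + t <= 1 becomes r <= l.\<close>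
  define r where "r = q / (1 - q)"
  define z where "z = r + l\<^sup>2"
  have l: "0 \<le> l" "l \<le> 1" "W = l * M" "l\<^sup>2 * M = q * (1 - t)" using ell by (auto simp: l_def M_def)
  have M: "M = (1 - q) * t" by (simp add: M_def)
  have v: "0 \<le> v" "v \<le> 1" "w = 1 - v" "e \<le> v" using assms w_le by (auto simp: v_def)
  have r: "0 < r" "q * (1 + r) = r" "(1 - q) * (1 + r) = 1"
    using q by (auto simp: r_def field_simps)
  have qr: "(1 - q) * r = q" using q by (simp add: r_def)
  have z0: "0 < z" using r(1) by (simp add: z_def add_pos_nonneg)
  have tz: "t * z = r"
  proof -
    have "(1 - q) * (t * z) = (1 - q) * r * t + l\<^sup>2 * M" by (simp add: z_def M algebra_simps)
    also have "(1 - q) * r * t + l\<^sup>2 * M = (1 - q) * r" unfolding l qr by (simp add: algebra_simps)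
    finally show ?thesis using q by simp
  qed
  have rl: "r \<le> l"
  proof (rule power2_le_imp_le)
    have "q * t \<le> (1 - q) * (1 - t)" using assms(1) by (simp add: algebra_simps)
    then have "q * (q * t) \<le> q * ((1 - q) * (1 - t))" using q by simp
    also have "\<dots> = (1 - q) * (l\<^sup>2 * M)" unfolding l by simp
    finally have "r\<^sup>2 * ((1 - q)\<^sup>2 * t) \<le> l\<^sup>2 * ((1 - q)\<^sup>2 * t)"
      using q by (simp add: r_def M power2_eq_square mult_ac)
    moreover have "0 < (1 - q)\<^sup>2 * t" using q t_pos by simp
    ultimately show "r\<^sup>2 \<le> l\<^sup>2" by (rule mult_right_le_imp_le)
  qed (use l in simp)
  define R where "R = 2 * (1 - 2 * q) * (1 + l) * M + q * (2 - q) + e * (q\<^sup>2 - 2 * l * (1 + l) * M)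
      + w * ((1 + l) * (q\<^sup>2 - 2 * (1 + l\<^sup>2) * M) / 2)"
  \<comment> \<open>At l = 1, that is x = y, s equals e + w and the core vanishes. The left-hand
    side of the claim vanishes there too, since t - q is a multiple of 1 - l^2; a common factor 1 -
    l cancels.\<close>
  have core: "core = 2 * w * ((1 - l) * R)"
  proof -
    have h1: "q * t = q - l\<^sup>2 * M" unfolding l by (simp add: algebra_simps)
    have h2: "(1 - l\<^sup>2) * q * M = q - q\<^sup>2 - l\<^sup>2 * M"
    proof -
      have "(1 - l\<^sup>2) * q * M = q * M - q * (l\<^sup>2 * M)" by (simp add: algebra_simps)
      then show ?thesis unfolding l(4) unfolding M by (simp add: algebra_simps power2_eq_square)
    qed
    have "core = 2 * w * ((1 - l) * R) + (2 * e\<^sup>2 - 2 * s\<^sup>2) * (q * t - (q - l\<^sup>2 * M))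
        + 8 * w * ((1 - l\<^sup>2) * q * M - (q - q\<^sup>2 - l\<^sup>2 * M))"
      unfolding core_def s_def unfolding l_def[symmetric] M_def[symmetric] unfolding R_def l(3)
      by (simp add: field_simps power2_eq_square)
    then show ?thesis unfolding h1 h2 by simp
  qed
  define R0 where "R0 = 2 * (1 - r) * (1 + l) + (2 + r) * z"
  define R2 where "R2 = r * z - 2 * l * (1 + l) * (1 + r)"
  define R3 where "R3 = (1 + l) * (r * z - 2 * (1 + l\<^sup>2) * (1 + r)) / 2"
  define B where "B = (1 - v) * (2 - q) + v * (2 - 2 * q + 2 * t)"
  define B' where "B' = (1 - v) * ((2 + r) * z) + v * (2 * z + 2 * r * (1 + r))"
  have poly: "R2 \<le> 0" "8 * v * r * (1 + l)\<^sup>2 * (1 - l) \<le> B' * (R0 + v * R2 + (1 - v) * R3)"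
    unfolding R0_def R2_def R3_def B'_def z_def
    using acute_poly_nonneg[of r l v] r rl l v by auto
  have Mz: "(1 + r) * (z * M) = r"
  proof -
    have "(1 + r) * (z * M) = ((1 - q) * (1 + r)) * (t * z)" by (simp add: M)
    then show ?thesis unfolding r(3) tz by simp
  qed
  have zR: "z * (1 + r)\<^sup>2 * R = r * (R0 + e * R2 + w * R3)"
  proof -
    have h: "(1 + r) * (1 - 2 * q) = 1 - r" "(2 - q) * (1 + r) = 2 + r"
      using r(2) by (simp_all add: algebra_simps)
    have "z * (1 + r)\<^sup>2 * R = 2 * ((1 + r) * (1 - 2 * q)) * (1 + l) * ((1 + r) * (z * M))
        + (q * (1 + r)) * ((2 - q) * (1 + r)) * z
        + e * ((q * (1 + r))\<^sup>2 * z - 2 * l * (1 + l) * (1 + r) * ((1 + r) * (z * M)))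
        + w * ((1 + l) * ((q * (1 + r))\<^sup>2 * z - 2 * (1 + l\<^sup>2) * (1 + r) * ((1 + r) * (z * M))) / 2)"
      unfolding R_def by (simp add: field_simps power2_eq_square)
    also have "\<dots> = r * (R0 + e * R2 + w * R3)"
      unfolding h r(2) Mz R0_def R2_def R3_def by (simp add: field_simps power2_eq_square)
    finally show ?thesis .
  qed
  have zB: "z * (1 + r) * B = B'"
  proof -
    have "z * (1 + r) * B = (1 - v) * (2 * (1 + r) - q * (1 + r)) * z
        + v * (2 * z * (1 + r) - 2 * z * (q * (1 + r)) + 2 * (1 + r) * (t * z))"
      unfolding B_def by (simp add: algebra_simps)
    then show ?thesis unfolding r(2) tz B'_def by (simp add: algebra_simps)
  qed
  have zD: "z * (1 + r) * (t - q) = r * (1 - l\<^sup>2)"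
  proof -
    have "z * (1 + r) * (t - q) = (1 + r) * (t * z) - z * (q * (1 + r))" by (simp add: algebra_simps)
    then show ?thesis unfolding tz r(2) by (simp add: z_def algebra_simps)
  qed
  have B'0: "0 \<le> B'" unfolding B'_def using v z0 r by (intro add_nonneg_nonneg mult_nonneg_nonneg) auto
  \<comment> \<open>As R2 <= 0, the worst case of e <= v is e = v.\<close>
  have "R0 + v * R2 + (1 - v) * R3 \<le> R0 + e * R2 + w * R3"
    using mult_right_mono_neg[OF v(4) poly(1)] v(3) by simp
  then have "8 * v * r * (1 + l)\<^sup>2 * (1 - l) \<le> B' * (R0 + e * R2 + w * R3)"
    using poly(2) mult_left_mono[OF _ B'0] order.trans by blast
  then have "((1 - l) * r) * (8 * v * r * (1 + l)\<^sup>2 * (1 - l)) \<le> ((1 - l) * r) * (B' * (R0 + e * R2 + w * R3))"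
    using l r by (intro mult_left_mono) auto
  moreover have "((1 - l) * r) * (8 * v * r * (1 + l)\<^sup>2 * (1 - l)) =
      (z\<^sup>2 * (1 + r) ^ 3) * (8 * v * (1 - q) * (t - q)\<^sup>2)"
  proof -
    have "(z\<^sup>2 * (1 + r) ^ 3) * (8 * v * (1 - q) * (t - q)\<^sup>2) =
        8 * v * ((1 - q) * (1 + r)) * (z * (1 + r) * (t - q))\<^sup>2"
      by (simp add: power_mult_distrib power2_eq_square power3_eq_cube)
    also have "\<dots> = ((1 - l) * r) * (8 * v * r * (1 + l)\<^sup>2 * (1 - l))"
      unfolding zD r(3) by (simp add: power2_eq_square algebra_simps)
    finally show ?thesis ..
  qed
  moreover have "((1 - l) * r) * (B' * (R0 + e * R2 + w * R3)) = (z\<^sup>2 * (1 + r) ^ 3) * (B * ((1 - l) * R))"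
  proof -
    have "(z\<^sup>2 * (1 + r) ^ 3) * (B * ((1 - l) * R)) = (1 - l) * (z * (1 + r) * B) * (z * (1 + r)\<^sup>2 * R)"
      by (simp add: power2_eq_square power3_eq_cube)
    then show ?thesis unfolding zB zR by (simp only: mult_ac)
  qed
  ultimately have "(z\<^sup>2 * (1 + r) ^ 3) * (8 * v * (1 - q) * (t - q)\<^sup>2) \<le> (z\<^sup>2 * (1 + r) ^ 3) * (B * ((1 - l) * R))"
    by simp
  moreover have "0 < z\<^sup>2 * (1 + r) ^ 3" using z0 r by simp
  ultimately have "8 * v * (1 - q) * (t - q)\<^sup>2 \<le> B * ((1 - l) * R)" by (rule mult_left_le_imp_le)
  then have "(2 * w) * (8 * v * (1 - q) * (t - q)\<^sup>2) \<le> (2 * w) * (B * ((1 - l) * R))"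
    using assms(2) by (intro mult_left_mono) auto
  moreover have "16 * w * (1 - w) * (1 - q) * (t - q)\<^sup>2 = (2 * w) * (8 * v * (1 - q) * (t - q)\<^sup>2)"
    by (simp add: v_def)
  moreover have "w * (2 - q) + (1 - w) * (2 - 2 * q + 2 * t) = B" by (simp add: B_def v_def)
  moreover have "B * core = (2 * w) * (B * ((1 - l) * R))" by (simp add: core)
  ultimately show ?thesis by (simp only:)
qed

text \<open>The same reduced form of \<open>gap\<close>, now at s = 0.\<close>

lemma obtuse_core:
  assumes "1 \<le> q + t" "0 \<le> w" "0 \<le> e" "e \<le> 1 - w"
  defines "core \<equiv> - 4 * q * (1 - q) * w
    - 4 * W * e * (1 + w) - (2 * m - q\<^sup>2) * w\<^sup>2 - 2 * q * (1 - q) * e\<^sup>2 + (2 * q * t - q\<^sup>2) * e\<^sup>2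
    + (2 * m + q\<^sup>2) * (2 * w) + q * (2 - q) * (2 * e) + q\<^sup>2 * (2 * w * e)"
  shows "16 * w * (1 - w) * (1 - q) * (t - q)\<^sup>2 \<le> (w * (2 - q) + (1 - w) * (2 - 2 * q + 2 * t)) * core"
proof -
  define k where "k = 1 - t"
  \<comment> \<open>W is the geometric mean of q (1 - q) and k (1 - k), V their arithmetic mean.
    Since W enters with a negative coefficient, replacing it by V removes the square root at the
    right cost.\<close>
  define V where "V = (q * (1 - q) + k * (1 - k)) / 2"
  have t': "t = 1 - k" by (simp add: k_def)
  have k: "0 \<le> k" "k \<le> q" "q + k \<le> 1" using assms t by (auto simp: k_def)
  have WV: "W \<le> V"
  proof (rule power2_le_imp_le)
    have "4 * (V\<^sup>2 - W\<^sup>2) = (q * (1 - q) - k * (1 - k))\<^sup>2"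
      unfolding W(2) V_def t' by (simp add: power2_eq_square field_simps)
    then show "W\<^sup>2 \<le> V\<^sup>2" by (smt (verit) zero_le_power2)
    show "0 \<le> V" using k q by (simp add: V_def)
  qed
  define Y where "Y = 2 * w * (2 * m + q\<^sup>2 - 2 * q * (1 - q) + e * (q\<^sup>2 - 2 * V) + w * (q\<^sup>2 / 2 - m))
      + e * (2 * q * (2 - q) - 4 * V - 2 * q * k)"
  have "core - Y = 4 * e * (1 + w) * (V - W) + q\<^sup>2 * e\<^sup>2 + 2 * q * k * (e * (1 - e))"
    unfolding core_def Y_def t' by (simp add: field_simps power2_eq_square)
  moreover have "0 \<le> 4 * e * (1 + w) * (V - W) + q\<^sup>2 * e\<^sup>2 + 2 * q * k * (e * (1 - e))"
    using assms WV q k by (intro add_nonneg_nonneg mult_nonneg_nonneg) auto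
  ultimately have Yc: "Y \<le> core" by simp
  have "16 * w * (1 - w) * (1 - q) * (t - q)\<^sup>2 \<le> (w * (2 - q) + (1 - w) * (4 - 2 * q - 2 * k)) * Y"
    using obtuse_poly_nonneg[of k q e "1 - w"] k assms(2-4) unfolding Y_def V_def t' by simp
  also have "\<dots> \<le> (w * (2 - q) + (1 - w) * (4 - 2 * q - 2 * k)) * core"
    using Yc assms q k by (intro mult_left_mono add_nonneg_nonneg mult_nonneg_nonneg) auto
  also have "4 - 2 * q - 2 * k = 2 - 2 * q + 2 * t" by (simp add: t')
  finally show ?thesis .
qed

lemma gap_acute:
  assumes qt: "q + t \<le> 1"
  shows "0 \<le> gap (max d 0 + ell * max w 0)"
proof (cases "0 \<le> w")
  case w: True
  show ?thesis
  proof (cases "0 \<le> d")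
    case d: True
    show ?thesis
    proof (rule nonneg_of_core[OF w Hd_pos[OF w d] acute_core[OF qt w d]])
      show "d \<le> 1 - w" using d_le g_le w by simp
      have "q\<^sup>2 * (2 * w * d) \<le> q\<^sup>2 * K" using Kd[OF w d] by (intro mult_left_mono) auto
      then show "q * (2 - q) * (H - 2 * d) + q * (2 * t - q) * \<tau>\<^sup>2 + 4 * J * \<eta> * \<tau> + (P - 2 * w) * (2 * m + q\<^sup>2)
       + ((d + ell * w) * (4 * W - 2 * q * (2 - q)) + (d + ell * w)\<^sup>2 * q * (2 - q - 2 * t) - 4 * q * (1 - q) * w
          - 4 * W * d * (1 + w) - (2 * m - q\<^sup>2) * w\<^sup>2 - 2 * q * (1 - q) * d\<^sup>2 + (2 * q * t - q\<^sup>2) * d\<^sup>2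
          + (2 * m + q\<^sup>2) * (2 * w) + q * (2 - q) * (2 * d) + q\<^sup>2 * (2 * w * d)) \<le> gap (max d 0 + ell * max w 0)"
        using w d by (simp add: gap_def max_def algebra_simps power2_eq_square)
    qed
  next
    case False
    then have d: "d \<le> 0" by simp
    obtain Hd where Hd: "\<tau>\<^sup>2 \<le> (1 - w) * Hd" "0 \<le> Hd"
        "q * (2 - q) * Hd \<le> q * (2 - q) * H - 2 * q * (1 - q) * d\<^sup>2"
      using Hd_neg[OF w d] .
    \<comment> \<open>For d <= 0 the remaining terms in d are nonnegative except the one in d^2 that
      \<open>Hd_neg\<close> has absorbed, so the core is taken at e = 0.\<close>
    show ?thesis
    proof (rule nonneg_of_core[OF w Hd(1,2) acute_core[OF qt w order.refl]])
      have eq: "gap (max d 0 + ell * max w 0) = (q * (2 - q) * H - 2 * q * (1 - q) * d\<^sup>2) + q\<^sup>2 * K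
          - 4 * W * d * (1 + w) + (2 * q * t - q\<^sup>2) * d\<^sup>2
          + q * (2 * t - q) * \<tau>\<^sup>2 + 4 * J * \<eta> * \<tau> + (P - 2 * w) * (2 * m + q\<^sup>2)
       + ((0 + ell * w) * (4 * W - 2 * q * (2 - q)) + (0 + ell * w)\<^sup>2 * q * (2 - q - 2 * t) - 4 * q * (1 - q) * w
          - 4 * W * 0 * (1 + w) - (2 * m - q\<^sup>2) * w\<^sup>2 - 2 * q * (1 - q) * 0\<^sup>2 + (2 * q * t - q\<^sup>2) * 0\<^sup>2
          + (2 * m + q\<^sup>2) * (2 * w) + q * (2 - q) * (2 * 0) + q\<^sup>2 * (2 * w * 0))"
        using w d by (simp add: gap_def max_absorb1 max_absorb2 algebra_simps power2_eq_square)
      show "0 \<le> 1 - w" using w_le by simp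
      have "0 \<le> q\<^sup>2 * K" using K_nonneg by simp
      moreover have "4 * W * d * (1 + w) \<le> 0" using W w d by (simp add: mult_nonneg_nonpos mult_nonpos_nonneg)
      moreover have "0 \<le> (2 * q * t - q\<^sup>2) * d\<^sup>2" using q t by (simp add: power2_eq_square)
      ultimately show "q * (2 - q) * Hd + q * (2 * t - q) * \<tau>\<^sup>2 + 4 * J * \<eta> * \<tau> + (P - 2 * w) * (2 * m + q\<^sup>2)
       + ((0 + ell * w) * (4 * W - 2 * q * (2 - q)) + (0 + ell * w)\<^sup>2 * q * (2 - q - 2 * t) - 4 * q * (1 - q) * w
          - 4 * W * 0 * (1 + w) - (2 * m - q\<^sup>2) * w\<^sup>2 - 2 * q * (1 - q) * 0\<^sup>2 + (2 * q * t - q\<^sup>2) * 0\<^sup>2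
          + (2 * m + q\<^sup>2) * (2 * w) + q * (2 - q) * (2 * 0) + q\<^sup>2 * (2 * w * 0)) \<le> gap (max d 0 + ell * max w 0)"
        using Hd(3) unfolding eq by linarith
    qed
  qed
next
  case False
  then have w: "w \<le> 0" by simp
  then have s: "max d 0 + ell * max w 0 = max d 0" by simp
  show ?thesis unfolding s using gap_w_neg[OF w] .
qed

lemma gap_obtuse:
  assumes qt: "1 \<le> q + t"
  shows "0 \<le> gap 0"
proof (cases "0 \<le> w")
  case w: True
  show ?thesis
  proof (cases "0 \<le> d")
    case d: True
    show ?thesis
    proof (rule nonneg_of_core[OF w Hd_pos[OF w d] obtuse_core[OF qt w d]])
      show "d \<le> 1 - w" using d_le g_le w by simp
      have "q\<^sup>2 * (2 * w * d) \<le> q\<^sup>2 * K" using Kd[OF w d] by (intro mult_left_mono) auto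
      then show "q * (2 - q) * (H - 2 * d) + q * (2 * t - q) * \<tau>\<^sup>2 + 4 * J * \<eta> * \<tau> + (P - 2 * w) * (2 * m + q\<^sup>2)
       + (- 4 * q * (1 - q) * w
          - 4 * W * d * (1 + w) - (2 * m - q\<^sup>2) * w\<^sup>2 - 2 * q * (1 - q) * d\<^sup>2 + (2 * q * t - q\<^sup>2) * d\<^sup>2
          + (2 * m + q\<^sup>2) * (2 * w) + q * (2 - q) * (2 * d) + q\<^sup>2 * (2 * w * d)) \<le> gap 0"
        by (simp add: gap_def algebra_simps power2_eq_square)
    qed
  next
    case False
    then have d: "d \<le> 0" by simp
    obtain Hd where Hd: "\<tau>\<^sup>2 \<le> (1 - w) * Hd" "0 \<le> Hd"
        "q * (2 - q) * Hd \<le> q * (2 - q) * H - 2 * q * (1 - q) * d\<^sup>2"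
      using Hd_neg[OF w d] .
    show ?thesis
    proof (rule nonneg_of_core[OF w Hd(1,2) obtuse_core[OF qt w order.refl]])
      have eq: "gap 0 = (q * (2 - q) * H - 2 * q * (1 - q) * d\<^sup>2) + q\<^sup>2 * K
          - 4 * W * d * (1 + w) + (2 * q * t - q\<^sup>2) * d\<^sup>2
          + q * (2 * t - q) * \<tau>\<^sup>2 + 4 * J * \<eta> * \<tau> + (P - 2 * w) * (2 * m + q\<^sup>2)
       + (- 4 * q * (1 - q) * w
          - 4 * W * 0 * (1 + w) - (2 * m - q\<^sup>2) * w\<^sup>2 - 2 * q * (1 - q) * 0\<^sup>2 + (2 * q * t - q\<^sup>2) * 0\<^sup>2
          + (2 * m + q\<^sup>2) * (2 * w) + q * (2 - q) * (2 * 0) + q\<^sup>2 * (2 * w * 0))"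
        by (simp add: gap_def algebra_simps power2_eq_square)
      show "0 \<le> 1 - w" using w_le by simp
      have "0 \<le> q\<^sup>2 * K" using K_nonneg by simp
      moreover have "4 * W * d * (1 + w) \<le> 0" using W w d by (simp add: mult_nonneg_nonpos mult_nonpos_nonneg)
      moreover have "0 \<le> (2 * q * t - q\<^sup>2) * d\<^sup>2" using q t by (simp add: power2_eq_square)
      ultimately show "q * (2 - q) * Hd + q * (2 * t - q) * \<tau>\<^sup>2 + 4 * J * \<eta> * \<tau> + (P - 2 * w) * (2 * m + q\<^sup>2)
       + (- 4 * q * (1 - q) * w
          - 4 * W * 0 * (1 + w) - (2 * m - q\<^sup>2) * w\<^sup>2 - 2 * q * (1 - q) * 0\<^sup>2 + (2 * q * t - q\<^sup>2) * 0\<^sup>2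
          + (2 * m + q\<^sup>2) * (2 * w) + q * (2 - q) * (2 * 0) + q\<^sup>2 * (2 * w * 0)) \<le> gap 0"
        using Hd(3) unfolding eq by linarith
    qed
  qed
next
  case False
  then have w: "w \<le> 0" by simp
  define e where "e = max d 0"
  have e: "0 \<le> e" "e \<le> 1" using d_le g_le by (auto simp: e_def)
  define k where "k = 1 - t"
  define V where "V = (q * (1 - q) + k * (1 - k)) / 2"
  have t': "t = 1 - k" by (simp add: k_def)
  have k: "0 \<le> k" "k \<le> q" "q + k \<le> 1" using qt t by (auto simp: k_def)
  have WV: "W \<le> V"
  proof (rule power2_le_imp_le)
    have "4 * (V\<^sup>2 - W\<^sup>2) = (q * (1 - q) - k * (1 - k))\<^sup>2"
      unfolding W(2) V_def t' by (simp add: power2_eq_square field_simps)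
    then show "W\<^sup>2 \<le> V\<^sup>2" by (smt (verit) zero_le_power2)
    show "0 \<le> V" using k q by (simp add: V_def)
  qed
  \<comment> \<open>The parameter e is settled by \<open>gap_w_neg\<close>; beyond q + t = 1,
    lowering it to 0 only enlarges the gap.\<close>
  have "gap 0 - gap e = e * (4 * (V - W) + 2 * ((q - k) * (1 - k)) + 2 * q * k * (1 - e) + q\<^sup>2 * e)"
    unfolding gap_def unfolding V_def t' by (simp add: field_simps power2_eq_square)
  also have "\<dots> \<ge> 0" using e k q WV by (intro mult_nonneg_nonneg add_nonneg_nonneg) auto
  finally show ?thesis using gap_w_neg[OF w] by (simp add: e_def)
qed

end

section \<open>Simultaneous comparison of the three coefficients\<close>

lemma coeff_axis:
  assumes "0 \<le> s"
  shows "16 * coeff2 q t W J 0 0 (sqrt s) 0 0 (- sqrt s) =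
      4 - 4 * ((1 - t) * (1 - q) - 2 * s * W + s\<^sup>2 * t * q) + 2 * q * (2 - q) * (1 - s)\<^sup>2"
    "coeff3 q t W 0 0 (sqrt s) 0 0 (- sqrt s) = (1 - s)\<^sup>2 * (q * (q + 2 * ((1 - q) * t) + 2 * W * s) / 16)"
    "coeff4 q t 0 0 (sqrt s) 0 0 (- sqrt s) = ((1 - s)\<^sup>2)\<^sup>2 * (q\<^sup>2 * (q\<^sup>2 + 4 * ((1 - q) * t)) / 256)"
proof -
  have s: "(sqrt s)\<^sup>2 = s" "sqrt s * sqrt s = s" using assms by simp_all
  show "16 * coeff2 q t W J 0 0 (sqrt s) 0 0 (- sqrt s) =
      4 - 4 * ((1 - t) * (1 - q) - 2 * s * W + s\<^sup>2 * t * q) + 2 * q * (2 - q) * (1 - s)\<^sup>2"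
    unfolding coeff2_def Let_def using assms by (simp add: s) (simp add: algebra_simps power2_eq_square)
  show "coeff3 q t W 0 0 (sqrt s) 0 0 (- sqrt s) = (1 - s)\<^sup>2 * (q * (q + 2 * ((1 - q) * t) + 2 * W * s) / 16)"
    unfolding coeff3_def using assms by (simp add: s) (simp add: power2_eq_square)
  show "coeff4 q t 0 0 (sqrt s) 0 0 (- sqrt s) = ((1 - s)\<^sup>2)\<^sup>2 * (q\<^sup>2 * (q\<^sup>2 + 4 * ((1 - q) * t)) / 256)"
    unfolding coeff4_def using assms by (simp add: s) (simp add: power2_eq_square power4_eq_xxxx)
qed

lemma coeff_le_axis:
  fixes q t W J a1 a2 a3 b1 b2 b3 :: real
  assumes q: "0 < q" "q < 1" and t: "q \<le> t" "t \<le> 1"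
    and W: "0 \<le> W" "W\<^sup>2 = (1 - q) * q * t * (1 - t)" and J: "J\<^sup>2 = q * (1 - q) * (t - q)\<^sup>2"
    and a: "a1\<^sup>2 + a2\<^sup>2 + a3\<^sup>2 \<le> 1" and b: "b1\<^sup>2 + b2\<^sup>2 + b3\<^sup>2 \<le> 1"
  shows "\<exists>s\<in>{0..1}. coeff2 q t W J a1 a2 a3 b1 b2 b3 \<le> coeff2 q t W J 0 0 (sqrt s) 0 0 (- sqrt s)
    \<and> coeff3 q t W a1 a2 a3 b1 b2 b3 \<le> coeff3 q t W 0 0 (sqrt s) 0 0 (- sqrt s)
    \<and> coeff4 q t a1 a2 a3 b1 b2 b3 \<le> coeff4 q t 0 0 (sqrt s) 0 0 (- sqrt s)"
proof -
  define h h' where "h = a2\<^sup>2 + a3\<^sup>2" and "h' = b2\<^sup>2 + b3\<^sup>2"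
  define g where "g = sqrt (h * h')"
  define w d \<tau> where "w = - a1 * b1" and "d = - (a2 * b2 + a3 * b3)" and "\<tau> = a2 * b3 - a3 * b2"
  define \<eta> P H K where "\<eta> = a1 - b1" and "P = a1\<^sup>2 + b1\<^sup>2" and "H = h + h'" and "K = h * b1\<^sup>2 + h' * a1\<^sup>2"
  have hp: "0 \<le> h" "0 \<le> h'" by (simp_all add: h_def h'_def)
  have gs: "g = sqrt h * sqrt h'" by (simp add: g_def real_sqrt_mult)
  interpret gap_setup q t W J P H K w d \<tau> \<eta> g
  proof
    show "2 * \<bar>w\<bar> \<le> P"
      using zero_le_power2[of "\<bar>a1\<bar> - \<bar>b1\<bar>"] by (simp add: w_def P_def abs_mult power2_diff)
    show "\<eta>\<^sup>2 = P + 2 * w" by (simp add: \<eta>_def P_def w_def power2_eq_square algebra_simps)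
    show "0 \<le> g" using hp by (simp add: g_def)
    have "g\<^sup>2 = h * h'" using hp by (simp add: g_def)
    then show "g\<^sup>2 = d\<^sup>2 + \<tau>\<^sup>2" by (simp add: h_def h'_def d_def \<tau>_def power2_eq_square algebra_simps)
    show "2 * g \<le> H" using arith_geo_mean_sqrt[OF hp] by (simp add: g_def H_def)
    have "0 \<le> (sqrt h * \<bar>b1\<bar> - sqrt h' * \<bar>a1\<bar>)\<^sup>2" by simp
    also have "\<dots> = K - 2 * \<bar>w\<bar> * g"
      using hp by (simp add: K_def w_def gs abs_mult power2_diff power_mult_distrib)
    finally show "2 * \<bar>w\<bar> * g \<le> K" by simp
    show "P + H \<le> 2" using a b by (simp add: P_def H_def h_def h'_def)
  qed (use assms in auto)
  define \<alpha> \<beta> where "\<alpha> = 1 - a1\<^sup>2 - a2\<^sup>2 - a3\<^sup>2" and "\<beta> = 1 - b1\<^sup>2 - b2\<^sup>2 - b3\<^sup>2"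
  have ab: "0 \<le> \<alpha>" "\<alpha> \<le> 1" "0 \<le> \<beta>" "\<beta> \<le> 1" 
    using a b zero_le_power2[of a1] zero_le_power2[of a2] zero_le_power2[of a3]
      zero_le_power2[of b1] zero_le_power2[of b2] zero_le_power2[of b3]
    unfolding \<alpha>_def \<beta>_def by linarith+
  define \<omega> \<delta> where "\<omega> = max w 0" and "\<delta> = max d 0"
  define f where "f = 1 - \<delta> - \<omega>"
  have wd: "0 \<le> \<omega>" "0 \<le> \<delta>" "w \<le> \<omega>" "d \<le> \<delta>" by (auto simp: \<omega>_def \<delta>_def)
  have u: "\<omega> + \<delta> \<le> \<bar>w\<bar> + g" using d_le by (auto simp: \<omega>_def \<delta>_def)
  then have f: "0 \<le> f" "f \<le> 1" using g_le wd by (auto simp: f_def)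
  \<comment> \<open>X = |a| |b|. Splitting off the first axis, Cauchy-Schwarz gives |w| + g <= X,
    and 2X <= |a|^2 + |b|^2 gives (1 - |a|^2)(1 - |b|^2) <= (1 - X)^2.\<close>
  have prod: "\<alpha> * \<beta> \<le> f\<^sup>2"
  proof -
    define X where "X = sqrt ((1 - \<alpha>) * (1 - \<beta>))"
    have "(1 - \<alpha>) * (1 - \<beta>) = w\<^sup>2 + h * h' + K"
      by (simp add: \<alpha>_def \<beta>_def w_def h_def h'_def K_def power2_eq_square algebra_simps)
    also have "h * h' = g\<^sup>2" using hp by (simp add: g_def)
    finally have "(\<bar>w\<bar> + g)\<^sup>2 \<le> (1 - \<alpha>) * (1 - \<beta>)" using K by (simp add: power2_sum)
    then have Xu: "\<bar>w\<bar> + g \<le> X" unfolding X_def by (rule real_le_rsqrt)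
    have "(1 - \<alpha>) * (1 - \<beta>) \<le> 1 * 1" using ab by (intro mult_mono) auto
    then have X1: "X \<le> 1" by (simp add: X_def)
    have "2 * X \<le> (1 - \<alpha>) + (1 - \<beta>)" using arith_geo_mean_sqrt[of "1 - \<alpha>" "1 - \<beta>"] ab by (simp add: X_def)
    moreover have "X\<^sup>2 = (1 - \<alpha>) * (1 - \<beta>)" using ab by (simp add: X_def)
    ultimately have "\<alpha> * \<beta> \<le> (1 - X)\<^sup>2" by (simp add: power2_eq_square algebra_simps)
    also have "\<dots> \<le> f\<^sup>2" using Xu X1 u by (intro power_mono) (auto simp: f_def)
    finally show ?thesis .
  qed
  define A where "A = q + 2 * m"
  have A: "0 < A" "2 * m \<le> A" using q m_pos by (auto simp: A_def)
  have c3: "coeff3 q t W a1 a2 a3 b1 b2 b3 \<le> f\<^sup>2 * (A + 2 * m * \<omega> + 2 * W * \<delta>) * (q / 16)"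
  proof -
    have "coeff3 q t W a1 a2 a3 b1 b2 b3 = \<alpha> * \<beta> * (A + 2 * m * w + 2 * W * d) * (q / 16)"
      unfolding coeff3_def \<alpha>_def[symmetric] \<beta>_def[symmetric] by (simp add: A_def w_def d_def field_simps)
    also have "\<dots> \<le> \<alpha> * \<beta> * (A + 2 * m * \<omega> + 2 * W * \<delta>) * (q / 16)"
    proof -
      have "m * w \<le> m * \<omega>" "W * d \<le> W * \<delta>" using wd m_pos W by (auto intro: mult_left_mono)
      then have "A + 2 * m * w + 2 * W * d \<le> A + 2 * m * \<omega> + 2 * W * \<delta>" by simp
      then show ?thesis using ab q by (intro mult_right_mono mult_left_mono) auto
    qed
    also have "\<dots> \<le> f\<^sup>2 * (A + 2 * m * \<omega> + 2 * W * \<delta>) * (q / 16)"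
    proof -
      have "0 \<le> m * \<omega>" "0 \<le> W * \<delta>" using wd m_pos W by auto
      then have "0 \<le> A + 2 * m * \<omega> + 2 * W * \<delta>" using A by simp
      then show ?thesis using prod q by (intro mult_right_mono) auto
    qed
    finally show ?thesis .
  qed
  \<comment> \<open>The t^4 comparison follows from s <= \<open>\<delta>\<close> +
    \<open>\<omega>\<close> alone, since then f <= 1 - s. This leaves the gap and the cubic
    inequality \<open>A3\<close>.\<close>
  have reduce: "\<exists>s\<in>{0..1}. coeff2 q t W J a1 a2 a3 b1 b2 b3 \<le> coeff2 q t W J 0 0 (sqrt s) 0 0 (- sqrt s)
    \<and> coeff3 q t W a1 a2 a3 b1 b2 b3 \<le> coeff3 q t W 0 0 (sqrt s) 0 0 (- sqrt s)
    \<and> coeff4 q t a1 a2 a3 b1 b2 b3 \<le> coeff4 q t 0 0 (sqrt s) 0 0 (- sqrt s)"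
    if s: "0 \<le> s" "s \<le> \<delta> + \<omega>" and gs: "0 \<le> gap s"
      and A3: "f\<^sup>2 * (A + 2 * m * \<omega> + 2 * W * \<delta>) \<le> (1 - s)\<^sup>2 * (A + 2 * W * s)" for s
  proof (intro bexI conjI)
    show "s \<in> {0..1}" using s f by (auto simp: f_def)
    have "16 * coeff2 q t W J 0 0 (sqrt s) 0 0 (- sqrt s) - 16 * coeff2 q t W J a1 a2 a3 b1 b2 b3 = 2 * gap s"
      unfolding coeff_axis(1)[OF s(1)] unfolding gap_def coeff2_def Let_def
      by (simp add: w_def d_def \<tau>_def \<eta>_def P_def H_def K_def h_def h'_def field_simps power2_eq_square)
    then show "coeff2 q t W J a1 a2 a3 b1 b2 b3 \<le> coeff2 q t W J 0 0 (sqrt s) 0 0 (- sqrt s)" using gs by simp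
    have "f\<^sup>2 * (A + 2 * m * \<omega> + 2 * W * \<delta>) * (q / 16) \<le> (1 - s)\<^sup>2 * (A + 2 * W * s) * (q / 16)"
      using A3 q by (intro mult_right_mono) auto
    also have "\<dots> = coeff3 q t W 0 0 (sqrt s) 0 0 (- sqrt s)"
      unfolding coeff_axis(2)[OF s(1)] A_def by simp
    finally show "coeff3 q t W a1 a2 a3 b1 b2 b3 \<le> coeff3 q t W 0 0 (sqrt s) 0 0 (- sqrt s)" using c3 by simp
    have "f\<^sup>2 \<le> (1 - s)\<^sup>2" using s f by (intro power_mono) (auto simp: f_def)
    then have "\<alpha> * \<beta> \<le> (1 - s)\<^sup>2" using prod by simp
    then have "(\<alpha> * \<beta>)\<^sup>2 \<le> ((1 - s)\<^sup>2)\<^sup>2" using ab by (intro power_mono) auto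
    moreover have "0 \<le> q\<^sup>2 * (q\<^sup>2 + 4 * m) / 256" using m_pos by simp
    ultimately show "coeff4 q t a1 a2 a3 b1 b2 b3 \<le> coeff4 q t 0 0 (sqrt s) 0 0 (- sqrt s)"
      unfolding coeff_axis(3)[OF s(1)] unfolding coeff4_def \<alpha>_def[symmetric] \<beta>_def[symmetric] by (intro mult_right_mono)
  qed
  show ?thesis
  proof (cases "q + t \<le> 1")
    case True
    define l where "l = ell"
    define M where "M = m"
    have l: "0 \<le> l" "l \<le> 1" "W = l * M" using ell by (auto simp: l_def M_def)
    have M: "0 < M" "2 * M \<le> A" using m_pos A by (simp_all add: M_def)
    show ?thesis
    proof (rule reduce[of "\<delta> + l * \<omega>"])
      show "0 \<le> \<delta> + l * \<omega>" using wd l by simp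
      show "\<delta> + l * \<omega> \<le> \<delta> + \<omega>" using wd l by (simp add: mult_left_le_one_le)
      show "0 \<le> gap (\<delta> + l * \<omega>)" unfolding \<delta>_def \<omega>_def l_def by (rule gap_acute[OF True])
      \<comment> \<open>B is A + 2 W s for the chosen s, and 1 - s = f + (1 - l)
        \<open>\<omega>\<close>. The difference of the two sides of \<open>A3\<close> then has the
        factor (1 - l) \<open>\<omega>\<close>.\<close>
      define B where "B = A + 2 * l * M * \<delta> + 2 * l\<^sup>2 * M * \<omega>"
      have B: "A \<le> B" using l wd M by (simp add: B_def)
      have "f * (f * (M * (1 + l))) \<le> f * (1 * (M * 2))"
        using f M l by (intro mult_left_mono mult_mono) auto
      also have "\<dots> \<le> f * B" using M B f by (intro mult_left_mono) auto
      finally have "0 \<le> 2 * f * B - 2 * f * f * M * (1 + l)" by simp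
      moreover have "0 \<le> (1 - l) * \<omega> * B" using l wd A B by simp
      ultimately have "0 \<le> (1 - l) * \<omega> * ((2 * f * B - 2 * f * f * M * (1 + l)) + (1 - l) * \<omega> * B)"
        using l wd A B by (intro mult_nonneg_nonneg add_nonneg_nonneg) auto
      also have "\<dots> = (f + (1 - l) * \<omega>)\<^sup>2 * B - f\<^sup>2 * (B + 2 * M * \<omega> * (1 - l\<^sup>2))"
        by (simp add: algebra_simps power2_eq_square)
      finally have i: "f\<^sup>2 * (B + 2 * M * \<omega> * (1 - l\<^sup>2)) \<le> (f + (1 - l) * \<omega>)\<^sup>2 * B" by simp
      have e1: "B + 2 * M * \<omega> * (1 - l\<^sup>2) = A + 2 * m * \<omega> + 2 * W * \<delta>"
        unfolding l(3) M_def[symmetric] B_def by (simp add: algebra_simps)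
      have e2: "f + (1 - l) * \<omega> = 1 - (\<delta> + l * \<omega>)" by (simp add: f_def algebra_simps)
      have e3: "B = A + 2 * W * (\<delta> + l * \<omega>)"
        unfolding l(3) B_def by (simp add: algebra_simps power2_eq_square)
      show "f\<^sup>2 * (A + 2 * m * \<omega> + 2 * W * \<delta>) \<le> (1 - (\<delta> + l * \<omega>))\<^sup>2 * (A + 2 * W * (\<delta> + l * \<omega>))"
        using i unfolding e1 e2 unfolding e3 .
    qed
  next
    case False
    then have qt: "1 \<le> q + t" by simp
    show ?thesis
    proof (rule reduce[of 0])
      show "0 \<le> gap 0" by (rule gap_obtuse[OF qt])
      have "W = ell * m" "ell \<le> 1" using ell by auto
      then have Wm: "W \<le> m" using m_pos mult_right_mono[of ell 1 m] by simp
      \<comment> \<open>Both 2m and 2W are at most A, and \<open>\<delta>\<close> +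
        \<open>\<omega>\<close> = 1 - f, so the claim reduces to f^2 (2 - f) <= 1.\<close>
      have "2 * m * \<omega> + 2 * W * \<delta> \<le> A * \<omega> + A * \<delta>"
        using A Wm wd by (intro add_mono mult_right_mono) auto
      then have "f\<^sup>2 * (A + 2 * m * \<omega> + 2 * W * \<delta>) \<le> f\<^sup>2 * (A * (2 - f))"
        by (intro mult_left_mono) (auto simp: f_def algebra_simps)
      also have "\<dots> \<le> A"
      proof -
        have "f * (2 - f) \<le> 1" using zero_le_power2[of "1 - f"] by (simp add: power2_eq_square algebra_simps)
        then have "f * (f * (2 - f)) \<le> 1 * 1" using f by (intro mult_mono) auto
        then have "A * (f * (f * (2 - f))) \<le> A * 1" using A by (intro mult_left_mono) auto
        then show ?thesis by (simp add: power2_eq_square mult_ac)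
      qed
      finally show "f\<^sup>2 * (A + 2 * m * \<omega> + 2 * W * \<delta>) \<le> (1 - 0)\<^sup>2 * (A + 2 * W * 0)" by simp
    qed (use wd in auto)
  qed
qed

section \<open>The axis family and the theorem\<close>

lemma continuous_on_mult_ln: "continuous_on {0..} (\<lambda>x::real. x * ln x)"
proof -
  have "((\<lambda>x::real. x * ln x) \<longlongrightarrow> 0 * ln 0) (at_right 0)" by simp real_asymp
  then have "continuous (at 0 within {0..}) (\<lambda>x::real. x * ln x)"
    by (simp add: continuous_within at_within_Ici_at_right)
  moreover have "continuous (at x within {0..}) (\<lambda>x::real. x * ln x)" if "x > 0" for x
    using that by (intro continuous_intros) auto
  ultimately show ?thesis
    by (auto simp: continuous_on_eq_continuous_within le_less)
qed

lemma two_qubit_state_axis: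
  "unit_state 2 (two_qubit_state \<theta>)" "bloch1 2 (two_qubit_state \<theta>) = 0"
  "bloch2 2 (two_qubit_state \<theta>) = 0" "bloch3 2 (two_qubit_state \<theta>) = cos (2 * \<theta>)"
  by (simp_all add: unit_state_def bloch1_def bloch2_def bloch3_def two_qubit_state_def lessThan_2_nat
      norm_of_real cos_double)

text \<open>The input angle whose Bloch vector is (0, 0, r). Negative r gives angles above pi/4,
  which supplies the antiparallel second input.\<close>

definition axis_angle :: "real \<Rightarrow> real" where
  "axis_angle r = arccos r / 2"

lemma axis_angle:
  assumes "-1 \<le> r" "r \<le> 1"
  shows "cos (2 * axis_angle r) = r" "axis_angle r \<in> {0..pi / 2}"
  using assms arccos_lbound[of r] arccos_ubound[of r] by (auto simp: axis_angle_def)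

section \<open>Explicit eigenvalues along the axis family\<close>

lemma real_roots_prod:
  fixes p n t :: real
  assumes "4 * n \<le> p\<^sup>2"
  defines "D \<equiv> sqrt (p\<^sup>2 - 4 * n)"
  shows "(1 + (p + D) / 2 * t) * (1 + (p - D) / 2 * t) = 1 + p * t + n * t\<^sup>2"
proof -
  have "D * D = p\<^sup>2 - 4 * n" using assms by simp
  moreover have "4 * ((1 + (p + D) / 2 * t) * (1 + (p - D) / 2 * t)) = 4 + 4 * p * t + (p * p - D * D) * t\<^sup>2"
    by (simp add: field_simps power2_eq_square)
  ultimately show ?thesis by (simp add: power2_eq_square)
qed

lemma real_roots_nonneg:
  fixes p n :: real
  assumes "0 \<le> p" "0 \<le> n" "4 * n \<le> p\<^sup>2"
  shows "0 \<le> (p + sqrt (p\<^sup>2 - 4 * n)) / 2" "0 \<le> (p - sqrt (p\<^sup>2 - 4 * n)) / 2"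
proof -
  have "sqrt (p\<^sup>2 - 4 * n) \<le> p" using assms by (intro real_le_lsqrt) auto
  then show "0 \<le> (p - sqrt (p\<^sup>2 - 4 * n)) / 2" using assms by simp
  show "0 \<le> (p + sqrt (p\<^sup>2 - 4 * n)) / 2" using assms by simp
qed

text \<open>For Bloch vectors \<open>(0, 0, \<surd>s)\<close> and \<open>(0, 0, -\<surd>s)\<close> the reduced state splits into two blocks of rank
  two, labelled by \<open>e = \<plusminus>1\<close>.\<close>

context
  fixes C S c \<sigma> q t W :: real
  assumes CS: "C\<^sup>2 + S\<^sup>2 = 1" and cs: "c\<^sup>2 + \<sigma>\<^sup>2 = 1" and pos: "0 \<le> C" "0 \<le> S" "0 \<le> c" "0 \<le> \<sigma>"
    and q: "q = \<sigma>\<^sup>2" and t: "t = S\<^sup>2" and W: "W = S * C * \<sigma> * c"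
begin

definition blk_tr :: "real \<Rightarrow> real \<Rightarrow> real" where
  "blk_tr e s = (1 + e * (C * c - s * (S * \<sigma>))) / 2"
definition blk_det :: "real \<Rightarrow> real \<Rightarrow> real" where
  "blk_det e s = q * (1 + c\<^sup>2 + e * (2 * (C * c))) / 16 * (1 - s)\<^sup>2"

text \<open>Matching coefficients works because the squares of C c and S \<open>\<sigma>\<close> are
  polynomials in q and t, and their product is W.\<close>

lemma blk_prod:
  assumes s: "0 \<le> s"
  shows "(1 + blk_tr 1 s * T + blk_det 1 s * T\<^sup>2) * (1 + blk_tr (-1) s * T + blk_det (-1) s * T\<^sup>2) =
    1 + T + coeff2 q t W J 0 0 (sqrt s) 0 0 (- sqrt s) * T\<^sup>2 + coeff3 q t W 0 0 (sqrt s) 0 0 (- sqrt s) * T ^ 3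
      + coeff4 q t 0 0 (sqrt s) 0 0 (- sqrt s) * T ^ 4"
proof -
  have c2: "c\<^sup>2 = 1 - q" and C2: "C\<^sup>2 = 1 - t" using CS cs by (auto simp: q t)
  have e: "blk_tr 1 s + blk_tr (-1) s = 1" by (simp add: blk_tr_def field_simps)
  have W': "(C * c) * (S * \<sigma>) = W" "(S * \<sigma>)\<^sup>2 = t * q" "(C * c)\<^sup>2 = (1 - t) * (1 - q)"
    by (simp_all add: W q t power_mult_distrib c2[unfolded q] C2[unfolded t])
  define u n where "u = C * c" and "n = S * \<sigma>"
  have u: "u * n = W" "n\<^sup>2 = t * q" "u\<^sup>2 = (1 - t) * (1 - q)" using W' by (simp_all add: u_def n_def)
  have 2: "blk_tr 1 s * blk_tr (-1) s + blk_det 1 s + blk_det (-1) s = coeff2 q t W J 0 0 (sqrt s) 0 0 (- sqrt s)"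
  proof -
    have "16 * (blk_tr 1 s * blk_tr (-1) s + blk_det 1 s + blk_det (-1) s) =
        4 - 4 * (u\<^sup>2 - 2 * s * (u * n) + s\<^sup>2 * n\<^sup>2) + 2 * q * (1 + c\<^sup>2) * (1 - s)\<^sup>2"
      unfolding blk_tr_def blk_det_def u_def[symmetric] n_def[symmetric] by (simp add: field_simps power2_eq_square)
    also have "\<dots> = 16 * coeff2 q t W J 0 0 (sqrt s) 0 0 (- sqrt s)"
      unfolding u coeff_axis(1)[OF s] c2 by simp
    finally show ?thesis by simp
  qed
  have 3: "blk_tr 1 s * blk_det (-1) s + blk_tr (-1) s * blk_det 1 s = coeff3 q t W 0 0 (sqrt s) 0 0 (- sqrt s)"
  proof -
    have "blk_tr 1 s * blk_det (-1) s + blk_tr (-1) s * blk_det 1 s =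
        (1 - s)\<^sup>2 * (q * (1 + c\<^sup>2 - 2 * u\<^sup>2 + 2 * (u * n) * s) / 16)"
      unfolding blk_tr_def blk_det_def u_def[symmetric] n_def[symmetric] by (simp add: field_simps power2_eq_square)
    also have "1 + c\<^sup>2 - 2 * u\<^sup>2 + 2 * (u * n) * s = q + 2 * ((1 - q) * t) + 2 * W * s"
      unfolding u c2 by (simp add: algebra_simps)
    finally show ?thesis unfolding coeff_axis(2)[OF s] .
  qed
  have 4: "blk_det 1 s * blk_det (-1) s = coeff4 q t 0 0 (sqrt s) 0 0 (- sqrt s)"
  proof -
    have "blk_det 1 s * blk_det (-1) s = ((1 - s)\<^sup>2)\<^sup>2 * (q\<^sup>2 * ((1 + c\<^sup>2)\<^sup>2 - 4 * u\<^sup>2) / 256)"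
      unfolding blk_det_def u_def[symmetric] by (simp add: field_simps power2_eq_square)
    also have "(1 + c\<^sup>2)\<^sup>2 - 4 * u\<^sup>2 = q\<^sup>2 + 4 * ((1 - q) * t)"
      unfolding u c2 by (simp add: algebra_simps power2_eq_square)
    finally show ?thesis unfolding coeff_axis(3)[OF s] .
  qed
  have "(1 + blk_tr 1 s * T + blk_det 1 s * T\<^sup>2) * (1 + blk_tr (-1) s * T + blk_det (-1) s * T\<^sup>2) =
    1 + (blk_tr 1 s + blk_tr (-1) s) * T + (blk_tr 1 s * blk_tr (-1) s + blk_det 1 s + blk_det (-1) s) * T\<^sup>2
     + (blk_tr 1 s * blk_det (-1) s + blk_tr (-1) s * blk_det 1 s) * T ^ 3 + (blk_det 1 s * blk_det (-1) s) * T ^ 4"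
    by (simp add: algebra_simps power2_eq_square power3_eq_cube power4_eq_xxxx)
  then show ?thesis unfolding e 2 3 4 by simp
qed

text \<open>\<open>blk_det\<close> at s is (1 - s)^2 times its value at 0, and \<open>blk_tr\<close>
  is at least 1 - s times its value at 0. So the discriminant only has to be checked at s = 0, where
  it is the square c^2 (c + e C)^2 / 4.\<close>

lemma blk_bounds:
  assumes s: "0 \<le> s" "s \<le> 1" and e: "e = 1 \<or> e = -1"
  shows "0 \<le> blk_tr e s" "0 \<le> blk_det e s" "4 * blk_det e s \<le> (blk_tr e s)\<^sup>2"
proof -
  have le: "C * c \<le> 1" "S * \<sigma> \<le> 1 - C * c"
  proof -
    have "0 \<le> (C - c)\<^sup>2 + (S - \<sigma>)\<^sup>2" by simp
    also have "\<dots> = 2 - 2 * (C * c + S * \<sigma>)" using CS cs by (simp add: power2_diff)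
    finally show "S * \<sigma> \<le> 1 - C * c" by simp
    moreover have "0 \<le> S * \<sigma>" using pos by simp
    ultimately show "C * c \<le> 1" by simp
  qed
  have Ccp: "0 \<le> C * c" "0 \<le> S * \<sigma>" using pos by auto
  have base: "0 \<le> 1 + e * (C * c)" using e le Ccp by auto
  have lower: "(1 - s) * (1 + e * (C * c)) \<le> 1 + e * (C * c - s * (S * \<sigma>))"
  proof -
    have "0 \<le> 1 + e * (C * c) - e * (S * \<sigma>)" using e le Ccp by auto
    then have "0 \<le> s * (1 + e * (C * c) - e * (S * \<sigma>))" using s by simp
    then show ?thesis by (simp add: algebra_simps)
  qed
  have l0: "0 \<le> (1 - s) * (1 + e * (C * c))" using s base by simp
  then show "0 \<le> blk_tr e s" using lower by (simp add: blk_tr_def)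
  have sq: "(1 + e * (C * c))\<^sup>2 = q * (1 + c\<^sup>2 + e * (2 * (C * c))) + c\<^sup>2 * (c + e * C)\<^sup>2"
  proof -
    have "(1 + e * (C * c))\<^sup>2 - q * (1 + c\<^sup>2 + e * (2 * (C * c))) - c\<^sup>2 * (c + e * C)\<^sup>2 =
      (1 - q - c\<^sup>2) * (1 + c\<^sup>2 + e * (2 * (C * c)))"
      using e by (auto simp: power2_eq_square algebra_simps)
    moreover have "1 - q - c\<^sup>2 = 0" using cs by (simp add: q)
    ultimately show ?thesis by simp
  qed
  have nn: "0 \<le> 1 + c\<^sup>2 + e * (2 * (C * c))"
  proof -
    have "1 + c\<^sup>2 + e * (2 * (C * c)) = (c + e * C)\<^sup>2 + S\<^sup>2" using CS e by (auto simp: power2_eq_square algebra_simps)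
    then show ?thesis by simp
  qed
  moreover have "0 \<le> q" by (simp add: q)
  ultimately show "0 \<le> blk_det e s" by (simp add: blk_det_def)
  have "4 * blk_det e s = (1 - s)\<^sup>2 * (q * (1 + c\<^sup>2 + e * (2 * (C * c)))) / 4"
    by (simp add: blk_det_def)
  also have "\<dots> \<le> (1 - s)\<^sup>2 * (1 + e * (C * c))\<^sup>2 / 4"
    unfolding sq by (intro divide_right_mono mult_left_mono) auto
  also have "\<dots> = ((1 - s) * (1 + e * (C * c)))\<^sup>2 / 4" by (simp add: power_mult_distrib)
  also have "\<dots> \<le> (1 + e * (C * c - s * (S * \<sigma>)))\<^sup>2 / 4"
    using lower l0 by (intro divide_right_mono power_mono) auto
  also have "\<dots> = (blk_tr e s)\<^sup>2" by (simp add: blk_tr_def power_divide)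
  finally show "4 * blk_det e s \<le> (blk_tr e s)\<^sup>2" .
qed

definition blk_ev :: "real \<Rightarrow> real \<Rightarrow> real \<Rightarrow> real" where
  "blk_ev e f s = (blk_tr e s + f * sqrt ((blk_tr e s)\<^sup>2 - 4 * blk_det e s)) / 2"

definition axis_entropy :: "real \<Rightarrow> real" where
  "axis_entropy s = - (\<Sum>l\<leftarrow>[blk_ev 1 1 s, blk_ev 1 (-1) s, blk_ev (-1) 1 s, blk_ev (-1) (-1) s]. l * ln l) / ln 2"

lemma blk_ev_nonneg:
  assumes "0 \<le> s" "s \<le> 1" "e = 1 \<or> e = -1" "f = 1 \<or> f = -1"
  shows "0 \<le> blk_ev e f s"
  using assms(4) real_roots_nonneg[OF blk_bounds[OF assms(1-3)]] by (auto simp: blk_ev_def)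

lemma continuous_on_axis_entropy: "continuous_on {0..1} axis_entropy"
proof -
  have ev: "continuous_on {0..1} (\<lambda>s. blk_ev e f s * ln (blk_ev e f s))"
    if "e = 1 \<or> e = -1" "f = 1 \<or> f = -1" for e f
  proof (rule continuous_on_compose2[OF continuous_on_mult_ln])
    show "continuous_on {0..1} (blk_ev e f)"
      unfolding blk_ev_def[abs_def] blk_tr_def blk_det_def by (intro continuous_intros) auto
    show "blk_ev e f ` {0..1} \<subseteq> {0..}" using blk_ev_nonneg that by auto
  qed
  show ?thesis
    unfolding axis_entropy_def[abs_def] list.map sum_list.Cons sum_list.Nil
    by (intro continuous_on_divide continuous_on_minus continuous_on_add continuous_on_const ev) auto
qed

text \<open>Passing from roots of a characteristic polynomial to explicit eigenvalues makes the
  entropy visibly continuous in s.\<close>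

lemma vn_entropy_axis:
  assumes "A \<in> carrier_mat k k" "nonneg_spectrum A" "0 \<le> s" "s \<le> 1"
    and det: "\<And>T::real. det (1\<^sub>m k + of_real T \<cdot>\<^sub>m A) =
      of_real (1 + T + coeff2 q t W J 0 0 (sqrt s) 0 0 (- sqrt s) * T\<^sup>2
        + coeff3 q t W 0 0 (sqrt s) 0 0 (- sqrt s) * T ^ 3 + coeff4 q t 0 0 (sqrt s) 0 0 (- sqrt s) * T ^ 4)"
  shows "vn_entropy A = axis_entropy s"
  unfolding axis_entropy_def
proof (rule vn_entropy_eq_of_det[OF assms(1,2)])
  show "0 \<le> l" if "l \<in> set [blk_ev 1 1 s, blk_ev 1 (-1) s, blk_ev (-1) 1 s, blk_ev (-1) (-1) s]" for l
    using that blk_ev_nonneg[OF assms(3,4)] by auto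
  fix T :: real
  have pr: "(1 + blk_ev e 1 s * T) * (1 + blk_ev e (-1) s * T) = 1 + blk_tr e s * T + blk_det e s * T\<^sup>2"
    if "e = 1 \<or> e = -1" for e
    using real_roots_prod[OF blk_bounds(3)[OF assms(3,4) that], of T] by (simp add: blk_ev_def)
  have "(\<Prod>l\<leftarrow>[blk_ev 1 1 s, blk_ev 1 (-1) s, blk_ev (-1) 1 s, blk_ev (-1) (-1) s]. 1 + l * T) =
    ((1 + blk_ev 1 1 s * T) * (1 + blk_ev 1 (-1) s * T)) * ((1 + blk_ev (-1) 1 s * T) * (1 + blk_ev (-1) (-1) s * T))"
    by simp
  then show "det (1\<^sub>m k + of_real T \<cdot>\<^sub>m A) =
      of_real (\<Prod>l\<leftarrow>[blk_ev 1 1 s, blk_ev 1 (-1) s, blk_ev (-1) 1 s, blk_ev (-1) (-1) s]. 1 + l * T)"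
    using pr[of 1] pr[of "-1"] blk_prod[OF assms(3), of T J] det[of T] by simp
qed

end

section \<open>Attainment of the maximum\<close>

lemma reduced_BR_carrier: "reduced_BR m n \<Psi> \<in> carrier_mat (2 * n) (2 * n)"
  by (simp add: reduced_BR_def)

theorem theorem1:
  fixes x y z :: real
  assumes "normalized_U x y z"
    and "y = z"
  shows "\<exists>\<alpha>\<in>{0..pi/2}. \<exists>\<beta>\<in>{0..pi/2}.
           E_phi x y z \<alpha> \<beta> \<in> KE_set x y z
         \<and> (\<forall>e\<in>KE_set x y z. e \<le> E_phi x y z \<alpha> \<beta>)
         \<and> KE x y z = E_phi x y z \<alpha> \<beta>
         \<and> (\<forall>a\<in>{0..pi/2}. \<forall>b\<in>{0..pi/2}. E_phi x y z a b \<le> E_phi x y z \<alpha> \<beta>)"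
proof -
  have z: "z = y" using assms by simp
  have xy: "y \<le> x" "x \<le> pi / 4" "0 < y" "y < pi / 4" using assms(1) by (auto simp: normalized_U_def)
  define C S c s where "C = cos (2 * x)" and "S = sin (2 * x)" and "c = cos (2 * y)" and "s = sin (2 * y)"
  define q t W where "q = s\<^sup>2" and "t = S\<^sup>2" and "W = S * C * s * c"
  define J where "J = s * c * (t - q)"
  have CS: "C\<^sup>2 + S\<^sup>2 = 1" "c\<^sup>2 + s\<^sup>2 = 1" by (simp_all add: C_def S_def c_def s_def)
  have "0 < c" unfolding c_def using xy by (intro cos_gt_zero) auto
  moreover have "0 < s" unfolding s_def using xy by (intro sin_gt_zero) auto
  moreover have "0 \<le> C" unfolding C_def using xy by (intro cos_ge_zero) auto
  moreover have sS: "s \<le> S" unfolding s_def S_def using xy by (intro sin_monotone_2pi_le) auto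
  ultimately have pos: "0 \<le> C" "0 < S" "0 < c" "0 < s" by auto
  have q: "0 < q" "q < 1" using pos CS by (auto simp: q_def) (smt (verit) zero_less_power2)
  have t: "q \<le> t" "t \<le> 1" using sS pos CS by (auto simp: q_def t_def intro: power_mono) (smt (verit) zero_le_power2)
  have Wp: "0 \<le> W" using pos by (simp add: W_def)
  have c2: "c\<^sup>2 = 1 - q" "C\<^sup>2 = 1 - t" using CS by (auto simp: q_def t_def)
  have W2: "W\<^sup>2 = (1 - q) * q * t * (1 - t)"
    unfolding W_def power_mult_distrib c2 by (simp add: q_def t_def)
  have J2: "J\<^sup>2 = q * (1 - q) * (t - q)\<^sup>2"
    unfolding J_def power_mult_distrib c2 by (simp add: q_def)
  note ax = CS pos(1) less_imp_le[OF pos(2)] less_imp_le[OF pos(3)] less_imp_le[OF pos(4)] q_def t_def W_def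
  define ent where "ent = axis_entropy C S c s q"
  have det: "det (1\<^sub>m (2 * n) + of_real T \<cdot>\<^sub>m reduced_BR m n (out_amp x y y \<phi> \<psi>)) =
    of_real (1 + T + coeff2 q t W J (bloch1 m \<phi>) (bloch2 m \<phi>) (bloch3 m \<phi>) (bloch1 n \<psi>) (bloch2 n \<psi>) (bloch3 n \<psi>) * T\<^sup>2
      + coeff3 q t W (bloch1 m \<phi>) (bloch2 m \<phi>) (bloch3 m \<phi>) (bloch1 n \<psi>) (bloch2 n \<psi>) (bloch3 n \<psi>) * T ^ 3
      + coeff4 q t (bloch1 m \<phi>) (bloch2 m \<phi>) (bloch3 m \<phi>) (bloch1 n \<psi>) (bloch2 n \<psi>) (bloch3 n \<psi>) * T ^ 4)"
    if "n > 0" "unit_state m \<phi>" "unit_state n \<psi>" for m n \<phi> \<psi> and T :: real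
    using det_reduced_out_amp_coeffs[OF that, of T x y]
    unfolding q_def t_def W_def J_def C_def S_def c_def s_def .
  have ang: "cos (2 * axis_angle (sqrt u)) = sqrt u" "cos (2 * axis_angle (- sqrt u)) = - sqrt u"
    "axis_angle (sqrt u) \<in> {0..pi / 2}" "axis_angle (- sqrt u) \<in> {0..pi / 2}" if "0 \<le> u" "u \<le> 1" for u
  proof -
    have "0 \<le> sqrt u" "sqrt u \<le> 1" using that by simp_all
    then show "cos (2 * axis_angle (sqrt u)) = sqrt u" "cos (2 * axis_angle (- sqrt u)) = - sqrt u"
      "axis_angle (sqrt u) \<in> {0..pi / 2}" "axis_angle (- sqrt u) \<in> {0..pi / 2}"
      by (intro axis_angle; linarith)+
  qed
  let ?A = "\<lambda>u. axis_angle (sqrt u)" and ?B = "\<lambda>u. axis_angle (- sqrt u)"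
  note tq = two_qubit_state_axis
  have Eent: "E_phi x y y (?A u) (?B u) = ent u" if u: "0 \<le> u" "u \<le> 1" for u
    unfolding E_phi_def ent_out_def ent_def
    by (rule vn_entropy_axis[where J = J, OF ax reduced_BR_carrier nonneg_spectrum_reduced_BR u])
      (use det[OF _ tq(1)[of "?A u"] tq(1)[of "?B u"]] ang[OF u] in \<open>simp add: tq\<close>)
  have upper: "\<exists>u\<in>{0..1}. e \<le> ent u" if "e \<in> KE_set x y y" for e
  proof -
    obtain m n \<phi> \<psi> where e: "e = ent_out x y y m n \<phi> \<psi>" and n: "0 < n" "unit_state m \<phi>" "unit_state n \<psi>"
      using \<open>e \<in> KE_set x y y\<close> unfolding KE_set_def by blast
    obtain u where u: "u \<in> {0..1}" and le:
      "coeff2 q t W J (bloch1 m \<phi>) (bloch2 m \<phi>) (bloch3 m \<phi>) (bloch1 n \<psi>) (bloch2 n \<psi>) (bloch3 n \<psi>)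
        \<le> coeff2 q t W J 0 0 (sqrt u) 0 0 (- sqrt u)"
      "coeff3 q t W (bloch1 m \<phi>) (bloch2 m \<phi>) (bloch3 m \<phi>) (bloch1 n \<psi>) (bloch2 n \<psi>) (bloch3 n \<psi>)
        \<le> coeff3 q t W 0 0 (sqrt u) 0 0 (- sqrt u)"
      "coeff4 q t (bloch1 m \<phi>) (bloch2 m \<phi>) (bloch3 m \<phi>) (bloch1 n \<psi>) (bloch2 n \<psi>) (bloch3 n \<psi>)
        \<le> coeff4 q t 0 0 (sqrt u) 0 0 (- sqrt u)"
      using coeff_le_axis[OF q t Wp W2 J2 bloch_norm_le[OF n(2)] bloch_norm_le[OF n(3)]] by blast
    have u': "0 \<le> u" "u \<le> 1" using u by auto
    have "e \<le> E_phi x y y (?A u) (?B u)"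
      unfolding e E_phi_def ent_out_def
      by (rule vn_entropy_mono[OF reduced_BR_carrier nonneg_spectrum_reduced_BR reduced_BR_carrier
            nonneg_spectrum_reduced_BR det[OF n] _ le])
        (use det[OF _ tq(1)[of "?A u"] tq(1)[of "?B u"]] ang[OF u'] in \<open>simp add: tq\<close>)
    then show ?thesis using u Eent[OF u'] by auto
  qed
  \<comment> \<open>Every entangling value is at most \<open>ent\<close> at some parameter in
    [0, 1], so the maximiser over this compact interval beats all of them.\<close>
  have "continuous_on {0..1} ent" unfolding ent_def by (rule continuous_on_axis_entropy[OF ax])
  then obtain u where u: "u \<in> {0..1}" "\<And>v. v \<in> {0..1} \<Longrightarrow> ent v \<le> ent u"
    using continuous_attains_sup[of "{0..1::real}" ent] by auto
  then have u': "0 \<le> u" "u \<le> 1" by auto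
  have in_KE: "E_phi x y y a b \<in> KE_set x y y" for a b
    unfolding KE_set_def E_phi_def using two_qubit_state_axis(1) zero_less_numeral by blast
  have max: "e \<le> E_phi x y y (?A u) (?B u)" if "e \<in> KE_set x y y" for e
    using upper[OF that] u(2) Eent[OF u'] by force
  have "KE x y y = E_phi x y y (?A u) (?B u)"
    unfolding KE_def by (rule cSup_eq_maximum[OF in_KE max])
  then show ?thesis unfolding z using ang(3,4)[OF u'] in_KE max by blast
qed

end
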